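(* Let $K$ be a field containing $\mathbb{Q}$ and $R=K[x_1,\ldots,x_n]$ the polynomial ring with $\deg x_i=1$. Let $m_1,\ldots,m_n$ and $d_{ij}$ ($1\le i\le n$, $1\le j\le m_i$) be positive integers, and let $I\subset R$ be the ideal generated by $$F_i=\prod_{j=1}^{m_i}L_{ij}^{d_{ij}}\quad (i=1,\ldots,n),\qquad L_{ij}=\xi_1^{(i,j)}x_1+\xi_2^{(i,j)}x_2+\cdots+\xi_n^{(i,j)}x_n,\ \ \xi_k^{(i,j)}\in K.$$ Assume the coefficients $\{\xi_k^{(i,j)} : 1\le i\le n,\ 1\le j\le m_i,\ 1\le k\le n\}$ are algebraically independent over $\mathbb{Q}$. Then (1) $I$ is an Artinian complete intersection ideal of $R$, and (2) $A=R/I$ has the strong Lefschetz property.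
   Context: A standard graded Artinian $K$-algebra is $A=\bigoplus_{i=0}^c A_i$ with $A_0=K$, generated by $A_1$, finite-dimensional, and $A_c\neq 0$. $A$ has the strong Lefschetz property (SLP) if there exists a linear form $z\in A_1$ such that the multiplication map $\times z^d: A_i\to A_{i+d}$ has full rank (i.e. is injective or surjective) for all $1\le d\le c-1$ and $0\le i\le c-d$; such $z$ is called a strong Lefschetz (SL) element. *)

theory Defs
  imports Complex_Main "HOL-Library.Poly_Mapping"
begin

text \<open>Polynomials over a field K in the variables x_0, x_1, ... (0-based indices).
  A monomial is a finitely supported exponent vector nat =>_0 nat; a polynomial is a
  finitely supported map from monomials to coefficients.  The ring
  K[x_0,...,x_(n-1)] is the subring polyR n of polynomials involving only x_0..x_(n-1).\<close>

type_synonym 'a mpoly = "(nat \<Rightarrow>\<^sub>0 nat) \<Rightarrow>\<^sub>0 'a"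

definition Var :: "nat \<Rightarrow> 'a::comm_ring_1 mpoly" where
  "Var i = Poly_Mapping.single (Poly_Mapping.single i 1) 1"

definition Const :: "'a::comm_ring_1 \<Rightarrow> 'a mpoly" where
  "Const c = Poly_Mapping.single 0 c"

definition mdeg :: "(nat \<Rightarrow>\<^sub>0 nat) \<Rightarrow> nat" where
  "mdeg m = (\<Sum>i\<in>Poly_Mapping.keys m. Poly_Mapping.lookup m i)"

definition polyR :: "nat \<Rightarrow> 'a::comm_ring_1 mpoly set" where
  "polyR n = {p. \<forall>m\<in>Poly_Mapping.keys p. Poly_Mapping.keys m \<subseteq> {..<n}}"

definition homog :: "nat \<Rightarrow> nat \<Rightarrow> 'a::comm_ring_1 mpoly set" where
  "homog n d = {p \<in> polyR n. \<forall>m\<in>Poly_Mapping.keys p. mdeg m = d}"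

definition gen_ideal :: "nat \<Rightarrow> nat \<Rightarrow> (nat \<Rightarrow> 'a::comm_ring_1 mpoly) \<Rightarrow> 'a mpoly set" where
  "gen_ideal n k F = {(\<Sum>i<k. g i * F i) | g. \<forall>i<k. g i \<in> polyR n}"

definition regular_sequence :: "nat \<Rightarrow> nat \<Rightarrow> (nat \<Rightarrow> 'a::comm_ring_1 mpoly) \<Rightarrow> bool" where
  "regular_sequence n k F \<longleftrightarrow>
     (\<forall>i<k. F i \<in> polyR n) \<and>
     1 \<notin> gen_ideal n k F \<and>
     (\<forall>i<k. \<forall>g\<in>polyR n. g * F i \<in> gen_ideal n i F \<longrightarrow> g \<in> gen_ideal n i F)"

definition complete_intersection :: "nat \<Rightarrow> 'a::comm_ring_1 mpoly set \<Rightarrow> bool" where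
  "complete_intersection n I \<longleftrightarrow> (\<exists>k F. regular_sequence n k F \<and> I = gen_ideal n k F)"

text \<open>For a homogeneous ideal I, the graded component A_d of A = R/I is R_d/(I \<inter> R_d).
  A_d = 0 iff R_d \<subseteq> I.  R/I is Artinian (finite-dimensional over K) iff A_d = 0 for all
  large d (each R_d being finite-dimensional).\<close>
definition artinian_quotient :: "nat \<Rightarrow> 'a::comm_ring_1 mpoly set \<Rightarrow> bool" where
  "artinian_quotient n I \<longleftrightarrow> (\<exists>N. \<forall>d\<ge>N. homog n d \<subseteq> I)"

text \<open>Multiplication by z^e from A_i to A_(i+e), z a linear form:
  injective on the quotients / surjective on the quotients.\<close>
definition mult_injective :: "nat \<Rightarrow> 'a::comm_ring_1 mpoly set \<Rightarrow> 'a mpoly \<Rightarrow> nat \<Rightarrow> nat \<Rightarrow> bool" where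
  "mult_injective n I z e i \<longleftrightarrow> (\<forall>f\<in>homog n i. z ^ e * f \<in> I \<longrightarrow> f \<in> I)"

definition mult_surjective :: "nat \<Rightarrow> 'a::comm_ring_1 mpoly set \<Rightarrow> 'a mpoly \<Rightarrow> nat \<Rightarrow> nat \<Rightarrow> bool" where
  "mult_surjective n I z e i \<longleftrightarrow> (\<forall>g\<in>homog n (i + e). \<exists>f\<in>homog n i. g - z ^ e * f \<in> I)"

definition socle_degree :: "nat \<Rightarrow> 'a::comm_ring_1 mpoly set \<Rightarrow> nat \<Rightarrow> bool" where
  "socle_degree n I c \<longleftrightarrow> \<not> homog n c \<subseteq> I \<and> (\<forall>d>c. homog n d \<subseteq> I)"

definition strong_lefschetz :: "nat \<Rightarrow> 'a::comm_ring_1 mpoly set \<Rightarrow> bool" where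
  "strong_lefschetz n I \<longleftrightarrow>
     (\<exists>c. socle_degree n I c \<and>
       (\<exists>z\<in>homog n 1. \<forall>e i. 1 \<le> e \<and> e + 1 \<le> c \<and> i + e \<le> c \<longrightarrow>
            mult_injective n I z e i \<or> mult_surjective n I z e i))"

definition alg_indep_over_Q :: "'i set \<Rightarrow> ('i \<Rightarrow> 'a::field_char_0) \<Rightarrow> bool" where
  "alg_indep_over_Q S v \<longleftrightarrow>
     (\<forall>P :: ('i \<Rightarrow>\<^sub>0 nat) \<Rightarrow>\<^sub>0 rat.
        P \<noteq> 0 \<longrightarrow> (\<forall>m\<in>Poly_Mapping.keys P. Poly_Mapping.keys m \<subseteq> S) \<longrightarrow>
        (\<Sum>m\<in>Poly_Mapping.keys P. of_rat (Poly_Mapping.lookup P m) * (\<Prod>j\<in>Poly_Mapping.keys m. v j ^ Poly_Mapping.lookup m j)) \<noteq> 0)"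

definition lin_form :: "nat \<Rightarrow> (nat \<Rightarrow> 'a::comm_ring_1) \<Rightarrow> 'a mpoly" where
  "lin_form n c = (\<Sum>k<n. Const (c k) * Var k)"

definition gen_F :: "nat \<Rightarrow> (nat \<Rightarrow> nat) \<Rightarrow> (nat \<Rightarrow> nat \<Rightarrow> nat) \<Rightarrow> (nat \<Rightarrow> nat \<Rightarrow> nat \<Rightarrow> 'a::comm_ring_1) \<Rightarrow> nat \<Rightarrow> 'a mpoly" where
  "gen_F n m d \<xi> i = (\<Prod>j<m i. lin_form n (\<xi> i j) ^ d i j)"

end

theory Submission
  imports Defs "Jordan_Normal_Form.Determinant"
begin

text \<open>Put \<open>D\<^sub>i = \<Sum>\<^sub>j d\<^sub>i\<^sub>j\<close>. For an exponent \<open>b\<close> let \<open>B\<^sub>b = x\<^sup>r \<Prod>\<^sub>i F\<^sub>i\<^sup>q\<close>, where \<open>q\<close> and \<open>r\<close> are the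
  quotients and remainders of the \<open>b\<^sub>i\<close> by the \<open>D\<^sub>i\<close>. In each degree there are as many \<open>B\<^sub>b\<close> as
  monomials, and if all \<open>L\<^sub>i\<^sub>j\<close> are specialised to \<open>x\<^sub>i\<close> then \<open>B\<^sub>b = x\<^sup>b\<close>. So the determinant of this family
  is a rational polynomial in the \<open>\<xi>\<close> that does not vanish at the specialisation, hence not at an
  algebraically independent point either, and the \<open>B\<^sub>b\<close> form a basis of the polynomial ring. The linear
  bijection \<open>x\<^sup>b \<mapsto> B\<^sub>b\<close> turns multiplication by \<open>x\<^sub>i\<close> to the power \<open>D\<^sub>i\<close> into multiplication by \<open>F\<^sub>i\<close>. It carries
  the monomial ideal of these powers to \<open>I\<close>, whence regularity and the Artinian property.

  Let \<open>c = \<Sum>\<^sub>i (D\<^sub>i - 1)\<close> and \<open>z = \<Sum>\<^sub>i x\<^sub>i\<close>. For the monomial ideal, \<open>z\<close> is the raising operator of a representation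
  of \<open>sl\<^sub>2\<close>, so its power of exponent \<open>c - 2k\<close> is injective on the component of degree \<open>k\<close>. Replacing each reduced
  \<open>B\<^sub>b\<close> of degree \<open>c - k\<close> by this power times the complementary monomial of degree \<open>k\<close> gives a family that
  is again independent at the specialisation; by the same determinant argument it is a
  basis at the generic point, which makes \<open>z\<close> a strong Lefschetz element.\<close>

section \<open>Rational polynomial functions and bases of generic families\<close>

abbreviation "keys \<equiv> Poly_Mapping.keys"
abbreviation "lookup \<equiv> Poly_Mapping.lookup"

lemma poly_mapping_sum_single:
  fixes p :: "'b \<Rightarrow>\<^sub>0 'c::comm_monoid_add"
  assumes "finite S" "keys p \<subseteq> S"
  shows "p = (\<Sum>k\<in>S. Poly_Mapping.single k (lookup p k))"
proof (rule poly_mapping_eqI)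
  fix k
  have "(\<Sum>s\<in>S. lookup (Poly_Mapping.single s (lookup p s)) k) = (\<Sum>s\<in>S. if s = k then lookup p k else 0)"
    by (intro sum.cong) (auto simp: lookup_single)
  also have "\<dots> = lookup p k"
    using assms by (auto simp: in_keys_iff)
  finally show "lookup p k = lookup (\<Sum>s\<in>S. Poly_Mapping.single s (lookup p s)) k"
    by (simp add: lookup_sum)
qed

section \<open>Evaluation of polynomials with rational coefficients\<close>

definition monom_val :: "('i \<Rightarrow> 'a::comm_semiring_1) \<Rightarrow> ('i \<Rightarrow>\<^sub>0 nat) \<Rightarrow> 'a" where
  "monom_val v m = (\<Prod>j\<in>keys m. v j ^ lookup m j)"

definition rat_val :: "('i \<Rightarrow> 'a::field_char_0) \<Rightarrow> (('i \<Rightarrow>\<^sub>0 nat) \<Rightarrow>\<^sub>0 rat) \<Rightarrow> 'a" where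
  "rat_val v P = (\<Sum>m\<in>keys P. of_rat (lookup P m) * monom_val v m)"

lemma monom_val_superset:
  assumes "finite S" "keys m \<subseteq> S"
  shows "monom_val v m = (\<Prod>j\<in>S. v j ^ lookup m j)"
  unfolding monom_val_def using assms
  by (intro prod.mono_neutral_left) (auto simp: in_keys_iff)

lemma monom_val_zero [simp]: "monom_val v 0 = 1"
  by (simp add: monom_val_def)

lemma monom_val_single [simp]: "monom_val v (Poly_Mapping.single i 1) = v i"
  by (simp add: monom_val_def)

lemma monom_val_add: "monom_val v (a + b) = monom_val v a * monom_val v b"
proof -
  have "keys (a + b) \<subseteq> keys a \<union> keys b" by (rule Poly_Mapping.keys_add)
  then show ?thesis
    using monom_val_superset[of "keys a \<union> keys b" "a + b" v]
      monom_val_superset[of "keys a \<union> keys b" a v] monom_val_superset[of "keys a \<union> keys b" b v]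
    by (simp add: lookup_add power_add prod.distrib)
qed

lemma rat_val_superset:
  assumes "finite S" "keys P \<subseteq> S"
  shows "rat_val v P = (\<Sum>m\<in>S. of_rat (lookup P m) * monom_val v m)"
  unfolding rat_val_def using assms
  by (intro sum.mono_neutral_left) (auto simp: in_keys_iff)

lemma rat_val_single [simp]: "rat_val v (Poly_Mapping.single m c) = of_rat c * monom_val v m"
  by (simp add: rat_val_def)

lemma rat_val_zero [simp]: "rat_val v 0 = 0"
  by (simp add: rat_val_def)

lemma rat_val_add: "rat_val v (P + Q) = rat_val v P + rat_val v Q"
proof -
  have "keys (P + Q) \<subseteq> keys P \<union> keys Q" by (rule Poly_Mapping.keys_add)
  then show ?thesis
    using rat_val_superset[of "keys P \<union> keys Q" "P + Q" v]
      rat_val_superset[of "keys P \<union> keys Q" P v] rat_val_superset[of "keys P \<union> keys Q" Q v]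
    by (simp add: lookup_add of_rat_add distrib_right sum.distrib)
qed

lemma rat_val_sum: "rat_val v (\<Sum>i\<in>I. P i) = (\<Sum>i\<in>I. rat_val v (P i))"
  by (induction I rule: infinite_finite_induct) (auto simp: rat_val_add)

lemma rat_val_mult: "rat_val v (P * Q) = rat_val v P * rat_val v Q"
proof -
  have "P * Q = (\<Sum>a\<in>keys P. \<Sum>b\<in>keys Q. Poly_Mapping.single (a + b) (lookup P a * lookup Q b))"
    by (subst (1 2) poly_mapping_sum_single[OF finite_keys order_refl])
      (simp add: sum_product mult_single)
  then have "rat_val v (P * Q) =
      (\<Sum>a\<in>keys P. \<Sum>b\<in>keys Q. (of_rat (lookup P a) * monom_val v a) * (of_rat (lookup Q b) * monom_val v b))"
    by (simp add: rat_val_sum of_rat_mult monom_val_add mult_ac)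
  then show ?thesis by (simp add: rat_val_def sum_product)
qed

text \<open>One polynomial \<open>P\<close> over the rationals represents \<open>f\<close> at every
  point, so that a nonzero value at one point can say something about another. The closure lemmas
  below recognise determinants as such functions without exhibiting \<open>P\<close>.\<close>

definition rat_poly_fun :: "(('i \<Rightarrow> 'a) \<Rightarrow> 'a::field_char_0) \<Rightarrow> bool" where
  "rat_poly_fun f \<longleftrightarrow> (\<exists>P. \<forall>v. f v = rat_val v P)"

lemma rat_poly_fun_of_rat: "rat_poly_fun (\<lambda>v. of_rat c)"
  unfolding rat_poly_fun_def by (rule exI[of _ "Poly_Mapping.single 0 c"]) simp

lemma rat_poly_fun_0: "rat_poly_fun (\<lambda>v. 0)"
  and rat_poly_fun_1: "rat_poly_fun (\<lambda>v. 1)"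
  using rat_poly_fun_of_rat[of 0] rat_poly_fun_of_rat[of 1] by simp_all

lemma rat_poly_fun_var: "rat_poly_fun (\<lambda>v. v i)"
  unfolding rat_poly_fun_def
  by (rule exI[of _ "Poly_Mapping.single (Poly_Mapping.single i 1) 1"]) (simp flip: One_nat_def)

lemma rat_poly_fun_add: "rat_poly_fun f \<Longrightarrow> rat_poly_fun g \<Longrightarrow> rat_poly_fun (\<lambda>v. f v + g v)"
  unfolding rat_poly_fun_def by (metis rat_val_add)

lemma rat_poly_fun_mult: "rat_poly_fun f \<Longrightarrow> rat_poly_fun g \<Longrightarrow> rat_poly_fun (\<lambda>v. f v * g v)"
  unfolding rat_poly_fun_def by (metis rat_val_mult)

lemma rat_poly_fun_sum:
  "(\<And>i. i \<in> I \<Longrightarrow> rat_poly_fun (f i)) \<Longrightarrow> rat_poly_fun (\<lambda>v. \<Sum>i\<in>I. f i v)"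
  by (induction I rule: infinite_finite_induct) (auto intro: rat_poly_fun_0 rat_poly_fun_add)

lemma rat_poly_fun_prod:
  "(\<And>i. i \<in> I \<Longrightarrow> rat_poly_fun (f i)) \<Longrightarrow> rat_poly_fun (\<lambda>v. \<Prod>i\<in>I. f i v)"
  by (induction I rule: infinite_finite_induct) (auto intro: rat_poly_fun_1 rat_poly_fun_mult)

text \<open>The monomials that involve a variable outside \<open>S\<close> vanish at both points, so they can be
  discarded before algebraic independence is applied.\<close>

lemma alg_indep_nonzero:
  fixes v w :: "'i \<Rightarrow> 'a::field_char_0"
  assumes indep: "alg_indep_over_Q S v" and f: "rat_poly_fun f"
    and w: "\<And>i. i \<notin> S \<Longrightarrow> w i = 0" and nz: "f w \<noteq> 0"
  shows "f (\<lambda>i. if i \<in> S then v i else 0) \<noteq> 0"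
proof -
  obtain P where P: "\<And>u. f u = rat_val u P" using f unfolding rat_poly_fun_def by blast
  define K where "K = {m \<in> keys P. keys m \<subseteq> S}"
  define Q where "Q = (\<Sum>m\<in>K. Poly_Mapping.single m (lookup P m))"
  have "finite K" by (simp add: K_def)
  have lookup_Q: "lookup Q m = (if m \<in> K then lookup P m else 0)" for m
  proof -
    have "lookup Q m = (\<Sum>k\<in>K. if k = m then lookup P m else 0)"
      unfolding Q_def lookup_sum by (intro sum.cong) (auto simp: lookup_single)
    then show ?thesis using \<open>finite K\<close> by simp
  qed
  have keys_Q: "keys Q = K"
    by (auto simp: lookup_Q in_keys_iff[of _ Q] in_keys_iff[of _ P] K_def split: if_splits)
  have val: "rat_val u P = rat_val u Q" if u: "\<And>i. i \<notin> S \<Longrightarrow> u i = 0" for u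
  proof -
    have "monom_val u m = 0" if "m \<in> keys P - K" for m
    proof -
      from that obtain j where "j \<in> keys m" "j \<notin> S" by (auto simp: K_def)
      then show ?thesis unfolding monom_val_def
        by (intro prod_zero) (auto simp: u in_keys_iff intro!: bexI[of _ j])
    qed
    then have "rat_val u P = (\<Sum>m\<in>K. of_rat (lookup P m) * monom_val u m)"
      unfolding rat_val_def by (intro sum.mono_neutral_right) (auto simp: K_def)
    also have "\<dots> = rat_val u Q"
      unfolding rat_val_def keys_Q by (intro sum.cong) (simp_all add: lookup_Q)
    finally show ?thesis .
  qed
  have "Q \<noteq> 0" using nz val[OF w] P by auto
  then have "(\<Sum>m\<in>keys Q. of_rat (lookup Q m) * (\<Prod>j\<in>keys m. v j ^ lookup m j)) \<noteq> 0"
    using indep keys_Q unfolding alg_indep_over_Q_def K_def by blast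
  also have "(\<Sum>m\<in>keys Q. of_rat (lookup Q m) * (\<Prod>j\<in>keys m. v j ^ lookup m j))
      = rat_val (\<lambda>i. if i \<in> S then v i else 0) Q"
    unfolding rat_val_def monom_val_def keys_Q
    by (intro sum.cong refl arg_cong2[where f = "(*)"] prod.cong) (auto simp: K_def)
  finally show ?thesis using val[of "\<lambda>i. if i \<in> S then v i else 0"] P by simp
qed

text \<open>Column \<open>j\<close> of the matrix holds the coordinates of the family member
  \<open>e j\<close>, so a nonzero determinant means independence and gives spanning. The
  enumeration \<open>e\<close> is chosen before \<open>v\<close>, which makes the determinant a
  single function of the point.\<close>

lemma family_determinant:
  fixes M :: "'p \<Rightarrow> 'b \<Rightarrow> 'b \<Rightarrow> 'a::field"
  assumes "finite T"
  obtains N e where "bij_betw e {..<N} T"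
    "\<And>v. det (mat N N (\<lambda>(i, j). M v (e j) (e i))) \<noteq> 0 \<longleftrightarrow>
      (\<forall>\<gamma>. (\<forall>c\<in>T. (\<Sum>b\<in>T. \<gamma> b * M v b c) = 0) \<longrightarrow> (\<forall>b\<in>T. \<gamma> b = 0))"
    "\<And>v (p :: 'b \<Rightarrow> 'a). det (mat N N (\<lambda>(i, j). M v (e j) (e i))) \<noteq> 0 \<Longrightarrow>
      \<exists>\<gamma>. \<forall>c\<in>T. (\<Sum>b\<in>T. \<gamma> b * M v b c) = p c"
proof -
  obtain e where e: "bij_betw e {..<card T} T"
    using ex_bij_betw_nat_finite[OF assms] atLeast0LessThan by metis
  define N where "N = card T"
  note e = e[folded N_def]
  define f where "f = the_inv_into {..<N} e"
  have fe: "f (e i) = i" if "i < N" for i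
    unfolding f_def using e that by (simp add: the_inv_into_f_f bij_betw_def)
  have ef: "e (f b) = b" "f b < N" if "b \<in> T" for b
    unfolding f_def using e that
    by (auto simp: f_the_inv_into_f_bij_betw dest: bij_betw_the_inv_into bij_betwE)
  let ?A = "\<lambda>v. mat N N (\<lambda>(i, j). M v (e j) (e i))"
  have Avec: "(?A v *\<^sub>v x) $ i = (\<Sum>b\<in>T. x $ f b * M v b (e i))"
    if "x \<in> carrier_vec N" "i < N" for v x i
  proof -
    have "(?A v *\<^sub>v x) $ i = (\<Sum>j<N. M v (e j) (e i) * x $ j)"
      using that by (simp add: scalar_prod_def lessThan_atLeast0)
    also have "\<dots> = (\<Sum>j<N. x $ f (e j) * M v (e j) (e i))"
      by (intro sum.cong) (auto simp: fe)
    also have "\<dots> = (\<Sum>b\<in>T. x $ f b * M v b (e i))"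
      by (rule sum.reindex_bij_betw[OF e])
    finally show ?thesis .
  qed
  show thesis
  proof (rule that[OF e])
    fix v
    have A: "?A v \<in> carrier_mat N N" by simp
    show "det (?A v) \<noteq> 0 \<longleftrightarrow>
      (\<forall>\<gamma>. (\<forall>c\<in>T. (\<Sum>b\<in>T. \<gamma> b * M v b c) = 0) \<longrightarrow> (\<forall>b\<in>T. \<gamma> b = 0))" (is "_ \<longleftrightarrow> ?R")
    proof
      assume d: "det (?A v) \<noteq> 0"
      show ?R
      proof (intro allI impI)
        fix \<gamma> assume *: "\<forall>c\<in>T. (\<Sum>b\<in>T. \<gamma> b * M v b c) = 0"
        define x where "x = vec N (\<lambda>i. \<gamma> (e i))"
        have x: "x \<in> carrier_vec N" by (simp add: x_def)
        have "?A v *\<^sub>v x = 0\<^sub>v N"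
        proof (rule eq_vecI)
          fix i assume "i < dim_vec (0\<^sub>v N :: 'a vec)"
          then have i: "i < N" by simp
          have "(?A v *\<^sub>v x) $ i = (\<Sum>b\<in>T. \<gamma> b * M v b (e i))"
            unfolding Avec[OF x i] by (intro sum.cong) (auto simp: x_def ef)
          also have "\<dots> = 0" using * i e by (auto dest: bij_betwE)
          finally show "(?A v *\<^sub>v x) $ i = 0\<^sub>v N $ i" using i by simp
        qed simp
        then have "x = 0\<^sub>v N" using d x det_0_iff_vec_prod_zero_field[OF A] by blast
        then show "\<forall>b\<in>T. \<gamma> b = 0"
          by (metis ef x_def index_vec index_zero_vec(1))
      qed
    next
      assume R: ?R
      show "det (?A v) \<noteq> 0"
      proof
        assume "det (?A v) = 0"
        then obtain x where x: "x \<in> carrier_vec N" "x \<noteq> 0\<^sub>v N" "?A v *\<^sub>v x = 0\<^sub>v N"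
          using det_0_iff_vec_prod_zero_field[OF A] by blast
        have "(\<Sum>b\<in>T. x $ f b * M v b c) = 0" if "c \<in> T" for c
          using Avec[OF x(1) ef(2)[OF that], of v] x(3) ef[OF that] by simp
        then have x0: "x $ f b = 0" if "b \<in> T" for b
          using R[rule_format, of "\<lambda>b. x $ f b" b] that by simp
        have "x $ i = 0" if "i < N" for i
        proof -
          have "e i \<in> T" using e that by (auto dest: bij_betwE)
          from x0[OF this] show ?thesis using fe[OF that] by simp
        qed
        then have "x = 0\<^sub>v N" using x(1) by (intro eq_vecI) auto
        with x(2) show False by simp
      qed
    qed
  next
    fix v and p :: "'b \<Rightarrow> 'a"
    assume d: "det (?A v) \<noteq> 0"
    have A: "?A v \<in> carrier_mat N N" by simp
    from det_non_zero_imp_unit[OF A d, where b = "()"] obtain B where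
      B: "B \<in> carrier_mat N N" "?A v * B = 1\<^sub>m N"
      by (auto simp: Units_def ring_mat_def)
    define y where "y = vec N (\<lambda>i. p (e i))"
    have y: "y \<in> carrier_vec N" by (simp add: y_def)
    have x: "B *\<^sub>v y \<in> carrier_vec N" using B(1) y by (rule mult_mat_vec_carrier)
    have "?A v *\<^sub>v (B *\<^sub>v y) = y"
      using assoc_mult_mat_vec[OF A B(1) y] B(2) y by simp
    then have "(\<Sum>b\<in>T. (B *\<^sub>v y) $ f b * M v b c) = p c" if "c \<in> T" for c
      using Avec[OF x, of "f c" v] ef that by (simp add: y_def)
    then show "\<exists>\<gamma>. \<forall>c\<in>T. (\<Sum>b\<in>T. \<gamma> b * M v b c) = p c"
      by (intro exI[of _ "\<lambda>b. (B *\<^sub>v y) $ f b"] ballI)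
  qed
qed

text \<open>By the Leibniz formula the determinant is a rational polynomial function of the point.
  Independence at \<open>w\<close> makes it nonzero there, and \<open>vw\<close>, the abstract form
  of genericity, carries this over to \<open>v\<close>.\<close>

lemma generic_family_basis:
  fixes M :: "('i \<Rightarrow> 'a::field_char_0) \<Rightarrow> 'b \<Rightarrow> 'b \<Rightarrow> 'a"
  assumes T: "finite T"
    and M: "\<And>b c. b \<in> T \<Longrightarrow> c \<in> T \<Longrightarrow> rat_poly_fun (\<lambda>v. M v b c)"
    and vw: "\<And>f. rat_poly_fun f \<Longrightarrow> f w \<noteq> 0 \<Longrightarrow> f v \<noteq> 0"
    and w: "\<And>\<gamma>. (\<forall>c\<in>T. (\<Sum>b\<in>T. \<gamma> b * M w b c) = 0) \<Longrightarrow> (\<forall>b\<in>T. \<gamma> b = 0)"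
  shows "(\<forall>c\<in>T. (\<Sum>b\<in>T. \<gamma> b * M v b c) = 0) \<Longrightarrow> (\<forall>b\<in>T. \<gamma> b = 0)"
    and "\<exists>\<gamma>. \<forall>c\<in>T. (\<Sum>b\<in>T. \<gamma> b * M v b c) = p c"
proof -
  obtain N e where e: "bij_betw e {..<N} T"
    and inj: "\<And>v. det (mat N N (\<lambda>(i, j). M v (e j) (e i))) \<noteq> 0 \<longleftrightarrow>
      (\<forall>\<gamma>. (\<forall>c\<in>T. (\<Sum>b\<in>T. \<gamma> b * M v b c) = 0) \<longrightarrow> (\<forall>b\<in>T. \<gamma> b = 0))"
    and surj: "\<And>v (p :: 'b \<Rightarrow> 'a). det (mat N N (\<lambda>(i, j). M v (e j) (e i))) \<noteq> 0 \<Longrightarrow>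
      \<exists>\<gamma>. \<forall>c\<in>T. (\<Sum>b\<in>T. \<gamma> b * M v b c) = p c"
    by (rule family_determinant[OF T, of M]) (rule that)
  have eT: "e i \<in> T" if "i < N" for i using e that by (auto dest: bij_betwE)
  have rp: "rat_poly_fun (\<lambda>v. det (mat N N (\<lambda>(i, j). M v (e j) (e i))))"
  proof -
    have "rat_poly_fun (\<lambda>v. signof p * (\<Prod>i = 0..<N. mat N N (\<lambda>(i, j). M v (e j) (e i)) $$ (i, p i)))"
      if p: "p permutes {0..<N}" for p
    proof (intro rat_poly_fun_mult rat_poly_fun_prod)
      show "rat_poly_fun (\<lambda>v :: 'i \<Rightarrow> 'a. signof p)"
        using rat_poly_fun_of_rat[of 1] rat_poly_fun_of_rat[of "-1"] by (auto simp: sign_def)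
      fix i assume i: "i \<in> {0..<N}"
      then have "p i < N" using permutes_in_image[OF p] by auto
      with i show "rat_poly_fun (\<lambda>v. mat N N (\<lambda>(i, j). M v (e j) (e i)) $$ (i, p i))"
        using M[OF eT eT] by simp
    qed
    then show ?thesis
      by (subst det_def'[of _ N]) (auto intro!: rat_poly_fun_sum)
  qed
  have "det (mat N N (\<lambda>(i, j). M w (e j) (e i))) \<noteq> 0"
    unfolding inj using w by blast
  then have d: "det (mat N N (\<lambda>(i, j). M v (e j) (e i))) \<noteq> 0" by (rule vw[OF rp])
  from d show "(\<forall>c\<in>T. (\<Sum>b\<in>T. \<gamma> b * M v b c) = 0) \<Longrightarrow> (\<forall>b\<in>T. \<gamma> b = 0)"
    unfolding inj by (elim allE impE)
  from d show "\<exists>\<gamma>. \<forall>c\<in>T. (\<Sum>b\<in>T. \<gamma> b * M v b c) = p c" by (rule surj)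
qed

section \<open>Monomials, homogeneous forms and ideals\<close>

lemma lookup_Const_mult [simp]: "lookup (Const c * p) b = c * lookup p b"
  unfolding Const_def by (simp flip: mult_map_scale_conv_mult add: map.rep_eq when_def)

lemma Const_1 [simp]: "Const 1 = 1"
  and Const_0 [simp]: "Const 0 = 0"
  by (simp_all add: Const_def)

lemma Const_mult: "Const (a * b) = Const a * Const b"
  by (simp add: Const_def mult_single)

lemma Const_add: "Const (a + b) = Const a + Const b"
  by (simp add: Const_def single_add)

lemma Const_mult_single: "Const c * Poly_Mapping.single s r = Poly_Mapping.single s (c * r)"
  by (simp add: Const_def mult_single)

lemma lookup_single_mult:
  fixes p :: "'a::comm_ring_1 mpoly"
  shows "lookup (Poly_Mapping.single s c * p) (s + t) = c * lookup p t"
proof -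
  have "lookup (Poly_Mapping.single s c * p) (s + t)
      = (\<Sum>k\<in>keys p. lookup (Poly_Mapping.single (s + k) (c * lookup p k)) (s + t))"
    by (subst (1) poly_mapping_sum_single[OF finite_keys order_refl, of p])
      (simp add: sum_distrib_left mult_single lookup_sum)
  also have "\<dots> = (\<Sum>k\<in>keys p. if k = t then c * lookup p t else 0)"
    by (intro sum.cong) (auto simp: lookup_single)
  also have "\<dots> = c * lookup p t" by (auto simp: in_keys_iff)
  finally show ?thesis .
qed

lemma lookup_single_mult_eq_0:
  fixes p :: "'a::comm_ring_1 mpoly"
  assumes "\<nexists>t. b = s + t"
  shows "lookup (Poly_Mapping.single s c * p) b = 0"
proof -
  have "b \<notin> keys (Poly_Mapping.single s c * p)"
    using Poly_Mapping.keys_mult[of "Poly_Mapping.single s c" p] assms by (auto split: if_splits)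
  then show ?thesis by (simp add: in_keys_iff)
qed

definition exps :: "nat \<Rightarrow> (nat \<Rightarrow> nat) \<Rightarrow> (nat \<Rightarrow>\<^sub>0 nat)" where
  "exps n f = (\<Sum>i<n. Poly_Mapping.single i (f i))"

lemma lookup_exps [simp]: "lookup (exps n f) i = (if i < n then f i else 0)"
proof -
  have "lookup (exps n f) i = (\<Sum>j<n. if j = i then f i else 0)"
    unfolding exps_def lookup_sum by (intro sum.cong) (auto simp: lookup_single)
  then show ?thesis by simp
qed

lemma keys_exps: "keys (exps n f) \<subseteq> {..<n}"
  by (auto simp: in_keys_iff[of _ "exps n f"] split: if_splits)

lemma lookup_outside: "lookup m i = 0" if "keys m \<subseteq> {..<n}" "\<not> i < n"
  using that by (auto simp: in_keys_iff[of _ m])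

lemma mdeg_eq_sum:
  assumes "keys m \<subseteq> {..<n}"
  shows "mdeg m = (\<Sum>i<n. lookup m i)"
  unfolding mdeg_def using assms
  by (intro sum.mono_neutral_left) (auto simp: in_keys_iff[of _ m])

lemma mdeg_exps [simp]: "mdeg (exps n f) = (\<Sum>i<n. f i)"
  by (subst mdeg_eq_sum[OF keys_exps]) simp

lemma mdeg_zero [simp]: "mdeg 0 = 0"
  and mdeg_single [simp]: "mdeg (Poly_Mapping.single i k) = k"
  by (simp_all add: mdeg_def)

lemma mdeg_add [simp]: "mdeg (a + b) = mdeg a + mdeg b"
proof -
  have f: "finite (keys a \<union> keys b)" by simp
  obtain n where n: "keys a \<union> keys b \<subseteq> {..<n}"
    using finite_nat_bounded[OF f] by blast
  moreover have "keys (a + b) \<subseteq> {..<n}" using n Poly_Mapping.keys_add[of a b] by blast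
  ultimately show ?thesis
    using mdeg_eq_sum[of _ n] by (simp add: lookup_add sum.distrib)
qed

lemma keys_add_nat: "keys (a + b) = keys a \<union> keys (b :: 'b \<Rightarrow>\<^sub>0 nat)"
  by (auto simp: in_keys_iff[of _ "a + b"] in_keys_iff[of _ a] in_keys_iff[of _ b] lookup_add)

definition monoms :: "nat \<Rightarrow> (nat \<Rightarrow>\<^sub>0 nat) set" where
  "monoms n = {m. keys m \<subseteq> {..<n}}"

lemma monoms_add [simp]: "a + b \<in> monoms n \<longleftrightarrow> a \<in> monoms n \<and> b \<in> monoms n"
  by (simp add: monoms_def keys_add_nat)

lemma monoms_0 [simp]: "0 \<in> monoms n"
  and exps_monoms [simp]: "exps n f \<in> monoms n"
  and monoms_single [simp]: "i < n \<Longrightarrow> Poly_Mapping.single i k \<in> monoms n"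
  by (auto simp: monoms_def dest: subsetD[OF keys_exps])

lemma finite_monoms: "finite {m \<in> monoms n. mdeg m \<le> N}"
proof (rule finite_subset)
  show "{m \<in> monoms n. mdeg m \<le> N} \<subseteq> exps n ` ({..<n} \<rightarrow>\<^sub>E {..N})"
  proof
    fix m assume m: "m \<in> {m \<in> monoms n. mdeg m \<le> N}"
    then have k: "keys m \<subseteq> {..<n}" by (simp add: monoms_def)
    have "lookup m i \<le> N" if "i < n" for i
      using member_le_sum[of i "{..<n}" "lookup m"] that m mdeg_eq_sum[OF k] by simp
    then have "restrict (lookup m) {..<n} \<in> {..<n} \<rightarrow>\<^sub>E {..N}" by auto
    moreover have "m = exps n (restrict (lookup m) {..<n})"
      by (rule poly_mapping_eqI) (simp add: lookup_outside[OF k])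
    ultimately show "m \<in> exps n ` ({..<n} \<rightarrow>\<^sub>E {..N})" by blast
  qed
qed (auto intro: finite_PiE)

section \<open>Supports, polynomials in the first \<open>n\<close> variables and homogeneous
  components\<close>

lemma polyR_iff: "p \<in> polyR n \<longleftrightarrow> keys p \<subseteq> monoms n"
  by (auto simp: polyR_def monoms_def)

lemma homog_iff: "p \<in> homog n d \<longleftrightarrow> keys p \<subseteq> {m \<in> monoms n. mdeg m = d}"
  by (auto simp: homog_def polyR_def monoms_def)

lemma keys_add_subset: "keys p \<subseteq> T \<Longrightarrow> keys q \<subseteq> T \<Longrightarrow> keys (p + q) \<subseteq> T"
  using Poly_Mapping.keys_add[of p q] by blast

lemma keys_sum_subset: "(\<And>i. i \<in> I \<Longrightarrow> keys (f i) \<subseteq> T) \<Longrightarrow> keys (\<Sum>i\<in>I. f i) \<subseteq> T"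
  by (induction I rule: infinite_finite_induct) (simp_all add: keys_add_subset)

lemma keys_Const_mult: "keys (Const c * p) \<subseteq> keys p"
  by (auto simp: in_keys_iff[of _ "Const c * p"] in_keys_iff[of _ p])

lemma keys_diff_subset:
  fixes p q :: "'b \<Rightarrow>\<^sub>0 'c::ab_group_add"
  shows "keys p \<subseteq> T \<Longrightarrow> keys q \<subseteq> T \<Longrightarrow> keys (p - q) \<subseteq> T"
  by (metis Un_least keys_diff order_trans)

lemma homog_polyR: "p \<in> homog n d \<Longrightarrow> p \<in> polyR n"
  by (simp add: homog_def)

lemma polyR_closed [simp]:
  "0 \<in> polyR n" "1 \<in> polyR n" "Const c \<in> polyR n"
  by (auto simp: polyR_iff Const_def)

lemma polyR_add: "p \<in> polyR n \<Longrightarrow> q \<in> polyR n \<Longrightarrow> p + q \<in> polyR n"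
  by (simp add: polyR_iff keys_add_subset)

lemma polyR_diff: "p \<in> polyR n \<Longrightarrow> q \<in> polyR n \<Longrightarrow> p - q \<in> polyR n"
  by (simp add: polyR_iff keys_diff_subset)

lemma polyR_sum: "(\<And>i. i \<in> I \<Longrightarrow> f i \<in> polyR n) \<Longrightarrow> (\<Sum>i\<in>I. f i) \<in> polyR n"
  by (simp add: polyR_iff keys_sum_subset)

lemma polyR_mult: "p \<in> polyR n \<Longrightarrow> q \<in> polyR n \<Longrightarrow> p * q \<in> polyR n"
  using Poly_Mapping.keys_mult[of p q] by (fastforce simp: polyR_iff)

lemma homog_sum: "(\<And>i. i \<in> I \<Longrightarrow> f i \<in> homog n d) \<Longrightarrow> (\<Sum>i\<in>I. f i) \<in> homog n d"
  by (simp only: homog_iff keys_sum_subset)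

lemma homog_mult: "p \<in> homog n d \<Longrightarrow> q \<in> homog n e \<Longrightarrow> p * q \<in> homog n (d + e)"
  using Poly_Mapping.keys_mult[of p q] by (fastforce simp: homog_iff)

lemma homog_one: "1 \<in> homog n 0"
  by (simp add: homog_iff)

lemma homog_power: "p \<in> homog n d \<Longrightarrow> p ^ k \<in> homog n (k * d)"
  by (induction k) (auto simp: homog_one homog_mult)

lemma homog_prod:
  "(\<And>i. i \<in> I \<Longrightarrow> f i \<in> homog n (d i)) \<Longrightarrow> (\<Prod>i\<in>I. f i) \<in> homog n (\<Sum>i\<in>I. d i)"
  by (induction I rule: infinite_finite_induct) (auto simp: homog_one homog_mult)

lemma homog_single: "m \<in> monoms n \<Longrightarrow> Poly_Mapping.single m c \<in> homog n (mdeg m)"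
  by (auto simp: homog_iff)

lemma lin_form_eq: "lin_form n c = (\<Sum>k<n. Poly_Mapping.single (Poly_Mapping.single k 1) (c k))"
  by (simp add: lin_form_def Const_def Var_def mult_single)

lemma homog_lin_form: "lin_form n c \<in> homog n 1"
  unfolding lin_form_eq
proof (rule homog_sum)
  fix k assume "k \<in> {..<n}"
  then show "Poly_Mapping.single (Poly_Mapping.single k 1) (c k) \<in> homog n 1"
    using homog_single[of "Poly_Mapping.single k 1" n "c k"] by simp
qed

section \<open>Closure properties of generated ideals\<close>

lemma gen_idealI: "(\<And>i. i < k \<Longrightarrow> g i \<in> polyR n) \<Longrightarrow> (\<Sum>i<k. g i * F i) \<in> gen_ideal n k F"
  by (auto simp: gen_ideal_def)

lemma gen_ideal_0: "0 \<in> gen_ideal n k F"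
  using gen_idealI[of k "\<lambda>_. 0" n F] by simp

lemma gen_ideal_add:
  assumes "p \<in> gen_ideal n k F" "q \<in> gen_ideal n k F"
  shows "p + q \<in> gen_ideal n k F"
proof -
  from assms obtain g h where
    "p = (\<Sum>i<k. g i * F i)" "\<And>i. i < k \<Longrightarrow> g i \<in> polyR n"
    "q = (\<Sum>i<k. h i * F i)" "\<And>i. i < k \<Longrightarrow> h i \<in> polyR n"
    by (auto simp: gen_ideal_def)
  then show ?thesis
    using gen_idealI[of k "\<lambda>i. g i + h i" n F] by (simp add: polyR_add distrib_right sum.distrib)
qed

lemma gen_ideal_mult:
  assumes "p \<in> gen_ideal n k F" "q \<in> polyR n"
  shows "q * p \<in> gen_ideal n k F"
proof -
  from assms obtain g where "p = (\<Sum>i<k. g i * F i)" "\<And>i. i < k \<Longrightarrow> g i \<in> polyR n"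
    by (auto simp: gen_ideal_def)
  then show ?thesis
    using gen_idealI[of k "\<lambda>i. q * g i" n F] assms(2)
    by (simp add: polyR_mult sum_distrib_left mult.assoc)
qed

lemma gen_ideal_sum: "(\<And>i. i \<in> I \<Longrightarrow> f i \<in> gen_ideal n k F) \<Longrightarrow> (\<Sum>i\<in>I. f i) \<in> gen_ideal n k F"
  by (induction I rule: infinite_finite_induct) (auto simp: gen_ideal_0 gen_ideal_add)

lemma gen_ideal_generator:
  assumes "j < k" shows "F j \<in> gen_ideal n k F"
proof -
  have "(\<Sum>i<k. (if i = j then 1 else 0) * F i) = (\<Sum>i<k. if i = j then F j else 0)"
    by (intro sum.cong) auto
  also have "\<dots> = F j" using assms by simp
  finally show ?thesis using gen_idealI[of k "\<lambda>i. if i = j then 1 else 0" n F] by simp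
qed

lemma gen_ideal_uminus:
  assumes "p \<in> gen_ideal n k F"
  shows "- p \<in> gen_ideal n k F"
proof -
  have "Const (-1) * p = - p" by (rule poly_mapping_eqI) simp
  then show ?thesis using gen_ideal_mult[OF assms polyR_closed(3)] by metis
qed

lemma gen_ideal_diff:
  "p \<in> gen_ideal n k F \<Longrightarrow> q \<in> gen_ideal n k F \<Longrightarrow> p - q \<in> gen_ideal n k F"
  using gen_ideal_add[of p n k F "- q"] gen_ideal_uminus by auto

section \<open>Linear maps given by the images of the monomials\<close>

definition lin :: "((nat \<Rightarrow>\<^sub>0 nat) \<Rightarrow> 'a::comm_ring_1 mpoly) \<Rightarrow> 'a mpoly \<Rightarrow> 'a mpoly" where
  "lin B p = (\<Sum>b\<in>keys p. Const (lookup p b) * B b)"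

lemma lin_superset:
  assumes "finite S" "keys p \<subseteq> S"
  shows "lin B p = (\<Sum>b\<in>S. Const (lookup p b) * B b)"
  unfolding lin_def using assms
  by (intro sum.mono_neutral_left) (auto simp: in_keys_iff)

lemma lookup_lin:
  assumes "finite S" "keys p \<subseteq> S"
  shows "lookup (lin B p) c = (\<Sum>b\<in>S. lookup p b * lookup (B b) c)"
  by (simp add: lin_superset[OF assms] lookup_sum)

lemma lin_0 [simp]: "lin B 0 = 0"
  by (simp add: lin_def)

lemma lin_single [simp]: "lin B (Poly_Mapping.single b c) = Const c * B b"
  by (simp add: lin_def)

lemma lin_add: "lin B (p + q) = lin B p + lin B q"
proof -
  have "keys (p + q) \<subseteq> keys p \<union> keys q" by (rule Poly_Mapping.keys_add)
  then show ?thesis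
    using lin_superset[of "keys p \<union> keys q" "p + q" B]
      lin_superset[of "keys p \<union> keys q" p B] lin_superset[of "keys p \<union> keys q" q B]
    by (simp add: lookup_add Const_add distrib_right sum.distrib)
qed

lemma lin_sum: "lin B (\<Sum>i\<in>I. p i) = (\<Sum>i\<in>I. lin B (p i))"
  by (induction I rule: infinite_finite_induct) (auto simp: lin_add)

lemma lin_diff: "lin B (p - q) = lin B p - lin B q"
  using lin_add[of B "p - q" q] by (simp add: algebra_simps)

lemma lin_Const_mult: "lin B (Const c * p) = Const c * lin B p"
  by (subst lin_superset[OF finite_keys keys_Const_mult])
    (simp add: lin_def Const_mult sum_distrib_left mult.assoc)

lemma lin_cong: "(\<And>b. b \<in> keys p \<Longrightarrow> B b = C b) \<Longrightarrow> lin B p = lin C p"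
  by (simp add: lin_def)

lemma lin_monomials [simp]: "lin (\<lambda>b. Poly_Mapping.single b 1) p = p"
  using poly_mapping_sum_single[OF finite_keys order_refl, of p]
  by (simp add: lin_def Const_mult_single)

lemma mult_lin: "q * lin B p = lin (\<lambda>b. q * B b) p"
  by (simp add: lin_def sum_distrib_left mult_ac)

lemma lin_single_mult: "lin B (Poly_Mapping.single s 1 * p) = lin (\<lambda>b. B (s + b)) p"
proof -
  have "Poly_Mapping.single s 1 * p = (\<Sum>b\<in>keys p. Poly_Mapping.single (s + b) (lookup p b))"
    by (subst (1) poly_mapping_sum_single[OF finite_keys order_refl, of p])
      (simp add: sum_distrib_left mult_single)
  then show ?thesis by (simp add: lin_sum lin_def[of _ p])
qed

lemma lin_lin: "lin B (lin C p) = lin (\<lambda>b. lin B (C b)) p"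
  by (simp add: lin_def[of C] lin_sum lin_Const_mult lin_def[of "\<lambda>b. lin B (C b)"])

lemma keys_lin:
  assumes "\<And>b. b \<in> keys p \<Longrightarrow> keys (B b) \<subseteq> T"
  shows "keys (lin B p) \<subseteq> T"
  unfolding lin_def using assms keys_Const_mult by (intro keys_sum_subset) blast

section \<open>Polynomials whose coefficients are rational polynomial functions of a point\<close>

definition rat_coeffs :: "(('i \<Rightarrow> 'a) \<Rightarrow> 'a::field_char_0 mpoly) \<Rightarrow> bool" where
  "rat_coeffs G \<longleftrightarrow> (\<forall>b. rat_poly_fun (\<lambda>v. lookup (G v) b))"

text \<open>Multipliers are closed under products by definition, which avoids a formula for the coefficients
  of a product whose factors both depend on the point.\<close>

definition rat_multiplier :: "(('i \<Rightarrow> 'a) \<Rightarrow> 'a::field_char_0 mpoly) \<Rightarrow> bool" where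
  "rat_multiplier H \<longleftrightarrow> (\<forall>G. rat_coeffs G \<longrightarrow> rat_coeffs (\<lambda>v. H v * G v))"

text \<open>A single term only shifts and scales, so each new coefficient is zero or
  \<open>c v\<close> times an old one. All the families used below are built from such terms by sums
  and products.\<close>

lemma rat_multiplier_single:
  assumes "rat_poly_fun c"
  shows "rat_multiplier (\<lambda>v. Poly_Mapping.single s (c v))"
  unfolding rat_multiplier_def rat_coeffs_def
proof (intro allI impI)
  fix G :: "('a \<Rightarrow> 'b) \<Rightarrow> 'b mpoly" and b
  assume G: "\<forall>b. rat_poly_fun (\<lambda>v. lookup (G v) b)"
  show "rat_poly_fun (\<lambda>v. lookup (Poly_Mapping.single s (c v) * G v) b)"
  proof (cases "\<exists>t. b = s + t")
    case True
    then obtain t where "b = s + t" by blast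
    then show ?thesis using G assms by (simp add: lookup_single_mult rat_poly_fun_mult)
  next
    case False
    then show ?thesis by (simp add: lookup_single_mult_eq_0 rat_poly_fun_0)
  qed
qed

lemma rat_multiplier_1: "rat_multiplier (\<lambda>v. 1)"
  by (simp add: rat_multiplier_def)

lemma rat_multiplier_mult:
  "rat_multiplier G \<Longrightarrow> rat_multiplier H \<Longrightarrow> rat_multiplier (\<lambda>v. G v * H v)"
  by (simp add: rat_multiplier_def mult.assoc)

lemma rat_multiplier_sum:
  assumes "\<And>i. i \<in> I \<Longrightarrow> rat_multiplier (H i)"
  shows "rat_multiplier (\<lambda>v. \<Sum>i\<in>I. H i v)"
  using assms unfolding rat_multiplier_def rat_coeffs_def
  by (auto simp: sum_distrib_right lookup_sum intro!: rat_poly_fun_sum)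

lemma rat_multiplier_prod:
  "(\<And>i. i \<in> I \<Longrightarrow> rat_multiplier (H i)) \<Longrightarrow> rat_multiplier (\<lambda>v. \<Prod>i\<in>I. H i v)"
  by (induction I rule: infinite_finite_induct) (auto intro: rat_multiplier_1 rat_multiplier_mult)

lemma rat_multiplier_power: "rat_multiplier H \<Longrightarrow> rat_multiplier (\<lambda>v. H v ^ k)"
  by (induction k) (auto intro: rat_multiplier_1 rat_multiplier_mult)

lemma rat_multiplier_lin_form:
  "(\<And>k. k < n \<Longrightarrow> rat_poly_fun (\<lambda>v. c v k)) \<Longrightarrow> rat_multiplier (\<lambda>v. lin_form n (c v))"
  unfolding lin_form_eq by (intro rat_multiplier_sum rat_multiplier_single) auto

text \<open>Multiplying the constant polynomial 1, whose coefficients are rational constants,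
  recovers \<open>H\<close> itself.\<close>

lemma rat_multiplier_coeffs:
  assumes "rat_multiplier H" shows "rat_coeffs H"
proof -
  have "rat_coeffs (\<lambda>v :: 'a \<Rightarrow> 'b. 1)"
    by (auto simp: rat_coeffs_def lookup_one when_def rat_poly_fun_0 rat_poly_fun_1)
  with assms have "rat_coeffs (\<lambda>v. H v * 1)" unfolding rat_multiplier_def by (elim allE impE)
  then show ?thesis by simp
qed

text \<open>A polynomial supported in \<open>T\<close> is the same as its vector of coefficients,
  and \<open>keys_B\<close> keeps the images supported in the same set, so \<open>lin (B v)\<close>
  has a square matrix to which the determinant argument applies.\<close>

lemma generic_lin_bijective:
  fixes B :: "('i \<Rightarrow> 'a::field_char_0) \<Rightarrow> (nat \<Rightarrow>\<^sub>0 nat) \<Rightarrow> 'a mpoly"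
  assumes T: "finite T"
    and B: "\<And>b. b \<in> T \<Longrightarrow> rat_coeffs (\<lambda>v. B v b)"
    and keys_B: "\<And>v b. b \<in> T \<Longrightarrow> keys (B v b) \<subseteq> T"
    and vw: "\<And>f. rat_poly_fun f \<Longrightarrow> f w \<noteq> 0 \<Longrightarrow> f v \<noteq> 0"
    and w: "\<And>q. keys q \<subseteq> T \<Longrightarrow> lin (B w) q = 0 \<Longrightarrow> q = 0"
  shows "keys q \<subseteq> T \<Longrightarrow> lin (B v) q = 0 \<Longrightarrow> q = 0"
    and "keys p \<subseteq> T \<Longrightarrow> \<exists>q. keys q \<subseteq> T \<and> lin (B v) q = p"
proof -
  define poly where "poly \<gamma> = (\<Sum>b\<in>T. Poly_Mapping.single b (\<gamma> b :: 'a))" for \<gamma>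
  have keys_poly: "keys (poly \<gamma>) \<subseteq> T" for \<gamma>
    unfolding poly_def by (rule keys_sum_subset) auto
  have lookup_poly: "lookup (poly \<gamma>) b = \<gamma> b" if "b \<in> T" for \<gamma> b
  proof -
    have "lookup (poly \<gamma>) b = (\<Sum>k\<in>T. if k = b then \<gamma> b else 0)"
      unfolding poly_def lookup_sum by (intro sum.cong) (auto simp: lookup_single)
    then show ?thesis using T that by simp
  qed
  have lookup_lin_poly: "lookup (lin (B u) (poly \<gamma>)) c = (\<Sum>b\<in>T. \<gamma> b * lookup (B u b) c)" for u \<gamma> c
    by (simp add: lookup_lin[OF T keys_poly] lookup_poly)
  have keys_lin_T: "keys (lin (B u) q) \<subseteq> T" if "keys q \<subseteq> T" for u q
    using that keys_B by (intro keys_lin) blast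
  have eqI: "p = q" if "keys p \<subseteq> T" "keys q \<subseteq> T" "\<And>c. c \<in> T \<Longrightarrow> lookup p c = lookup q c"
    for p q :: "'a mpoly"
  proof (rule poly_mapping_eqI)
    fix c show "lookup p c = lookup q c"
      using that by (metis not_in_keys_iff_lookup_eq_zero subsetD)
  qed
  have M: "rat_poly_fun (\<lambda>v. lookup (B v b) c)" if "b \<in> T" "c \<in> T" for b c
    using B that by (simp add: rat_coeffs_def)
  have inj_w: "\<forall>b\<in>T. \<gamma> b = 0" if "\<forall>c\<in>T. (\<Sum>b\<in>T. \<gamma> b * lookup (B w b) c) = 0" for \<gamma>
  proof -
    have "lin (B w) (poly \<gamma>) = 0"
      using that by (intro eqI keys_lin_T keys_poly) (auto simp: lookup_lin_poly)
    then have "poly \<gamma> = 0" by (rule w[OF keys_poly])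
    then show ?thesis using lookup_poly[of _ \<gamma>] by simp
  qed
  note basis = generic_family_basis[where M = "\<lambda>v b c. lookup (B v b) c" and T = T and v = v and w = w]
  have inj_v: "\<forall>b\<in>T. \<gamma> b = 0" if "\<forall>c\<in>T. (\<Sum>b\<in>T. \<gamma> b * lookup (B v b) c) = 0" for \<gamma>
    by (rule basis(1)) (rule T M vw inj_w that; assumption)+
  have surj_v: "\<exists>\<gamma>. \<forall>c\<in>T. (\<Sum>b\<in>T. \<gamma> b * lookup (B v b) c) = p c" for p
    by (rule basis(2)) (rule T M vw inj_w; assumption)+
  show "q = 0" if q: "keys q \<subseteq> T" "lin (B v) q = 0"
  proof -
    have "\<forall>c\<in>T. (\<Sum>b\<in>T. lookup q b * lookup (B v b) c) = 0"
      using q lookup_lin[OF T q(1), of "B v"] by simp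
    then have "\<forall>b\<in>T. lookup q b = 0" by (rule inj_v)
    then show ?thesis using q(1) by (intro eqI) auto
  qed
  show "\<exists>q. keys q \<subseteq> T \<and> lin (B v) q = p" if p: "keys p \<subseteq> T"
  proof -
    obtain \<gamma> where "\<forall>c\<in>T. (\<Sum>b\<in>T. \<gamma> b * lookup (B v b) c) = lookup p c"
      using surj_v[of "lookup p"] by (elim exE)
    then have "lin (B v) (poly \<gamma>) = p"
      by (intro eqI keys_lin_T keys_poly p) (auto simp: lookup_lin_poly)
    then show ?thesis using keys_poly[of \<gamma>] by (intro exI conjI)
  qed
qed

section \<open>The strong Lefschetz property of a monomial complete intersection\<close>

definition nonreduced :: "nat \<Rightarrow> nat \<Rightarrow> (nat \<Rightarrow> nat) \<Rightarrow> (nat \<Rightarrow>\<^sub>0 nat) set" where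
  "nonreduced n k D = {b \<in> monoms n. \<exists>j<k. D j \<le> lookup b j}"

text \<open>The ideal generated by the powers x_j^(D j) with j < k, described by supports instead of
  generators. The bound \<open>k\<close> is separate from \<open>n\<close> because regularity speaks
  of the initial segments of the generators.\<close>

definition mon_ideal :: "nat \<Rightarrow> nat \<Rightarrow> (nat \<Rightarrow> nat) \<Rightarrow> 'a::comm_ring_1 mpoly set" where
  "mon_ideal n k D = {p. keys p \<subseteq> nonreduced n k D}"

lemma mon_ideal_diff: "p \<in> mon_ideal n k D \<Longrightarrow> q \<in> mon_ideal n k D \<Longrightarrow> p - q \<in> mon_ideal n k D"
  by (simp add: mon_ideal_def keys_diff_subset)

lemma mon_ideal_sum: "(\<And>i. i \<in> I \<Longrightarrow> f i \<in> mon_ideal n k D) \<Longrightarrow> (\<Sum>i\<in>I. f i) \<in> mon_ideal n k D"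
  by (simp add: mon_ideal_def keys_sum_subset)

lemma mon_ideal_Const_mult: "p \<in> mon_ideal n k D \<Longrightarrow> Const c * p \<in> mon_ideal n k D"
  using keys_Const_mult[of c p] by (auto simp: mon_ideal_def)

lemma nonreduced_add: "a \<in> monoms n \<Longrightarrow> b \<in> nonreduced n k D \<Longrightarrow> a + b \<in> nonreduced n k D"
  by (auto simp: nonreduced_def lookup_add intro: trans_le_add2)

lemma mon_ideal_mult:
  assumes "p \<in> polyR n" "q \<in> mon_ideal n k D"
  shows "p * q \<in> mon_ideal n k D"
  using Poly_Mapping.keys_mult[of p q] assms nonreduced_add
  unfolding mon_ideal_def polyR_iff by fast

section \<open>The action of sl_2 on polynomials\<close>

definition lower_monom :: "nat \<Rightarrow> nat \<Rightarrow> (nat \<Rightarrow>\<^sub>0 nat) \<Rightarrow> (nat \<Rightarrow>\<^sub>0 nat)" where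
  "lower_monom n i b = exps n ((lookup b)(i := lookup b i - 1))"

text \<open>The two zeros of this coefficient matter: at exponent 0 it hides the truncated
  subtraction in \<open>lower_monom\<close>, and at exponent \<open>D i\<close> it keeps the
  monomial ideal stable under lowering.\<close>

definition lower_coeff :: "(nat \<Rightarrow> nat) \<Rightarrow> nat \<Rightarrow> (nat \<Rightarrow>\<^sub>0 nat) \<Rightarrow> 'a::comm_ring_1" where
  "lower_coeff D i b = of_nat (lookup b i) * (of_nat (D i) - of_nat (lookup b i))"

text \<open>The lowering operator of the tensor product of the irreducible representations of
  \<open>sl\<^sub>2\<close> of dimensions \<open>D i\<close>; the raising operator is multiplication by the sum of the variables.\<close>

definition lower :: "nat \<Rightarrow> (nat \<Rightarrow> nat) \<Rightarrow> 'a::comm_ring_1 mpoly \<Rightarrow> 'a mpoly" where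
  "lower n D = lin (\<lambda>b. \<Sum>i<n. Poly_Mapping.single (lower_monom n i b) (lower_coeff D i b))"

abbreviation varsum :: "nat \<Rightarrow> 'a::comm_ring_1 mpoly" where
  "varsum n \<equiv> lin_form n (\<lambda>_. 1)"

lemma lookup_lower_monom:
  "lookup (lower_monom n i b) j = (if j < n then if j = i then lookup b i - 1 else lookup b j else 0)"
  by (simp add: lower_monom_def)

lemma lower_homog:
  assumes "p \<in> homog n (Suc d)"
  shows "lower n D p \<in> homog n d"
proof -
  have "keys (lower n D p) \<subseteq> {m \<in> monoms n. mdeg m = d}"
    unfolding lower_def
  proof (intro keys_lin keys_sum_subset)
    fix b i assume b: "b \<in> keys p" and i: "i \<in> {..<n}"
    have k: "keys b \<subseteq> {..<n}" and deg: "mdeg b = Suc d"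
      using assms b by (auto simp: homog_iff monoms_def)
    show "keys (Poly_Mapping.single (lower_monom n i b) (lower_coeff D i b)) \<subseteq> {m \<in> monoms n. mdeg m = d}"
    proof (cases "lookup b i = 0")
      case False
      have "Suc (\<Sum>j<n. ((lookup b)(i := lookup b i - 1)) j) = (\<Sum>j<n. lookup b j)"
        using i False by (simp add: sum.remove[of "{..<n}" i])
      then have "mdeg (lower_monom n i b) = d"
        using deg mdeg_eq_sum[OF k] by (simp add: lower_monom_def)
      then show ?thesis by (auto simp: lower_monom_def)
    qed (simp add: lower_coeff_def)
  qed
  then show ?thesis by (simp add: homog_iff)
qed

lemma lower_homog_0:
  assumes "p \<in> homog n 0"
  shows "lower n D p = 0"
proof -
  have "lookup b i = 0" if "b \<in> keys p" for b i
  proof (cases "i < n")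
    case True
    have "keys b \<subseteq> {..<n}" "mdeg b = 0" using assms that by (auto simp: homog_iff monoms_def)
    then show ?thesis using mdeg_eq_sum[of b n] True by simp
  next
    case False
    then show ?thesis using assms that by (auto simp: homog_iff monoms_def intro: lookup_outside)
  qed
  then show ?thesis by (simp add: lower_def lin_def lower_coeff_def)
qed

text \<open>A monomial could leave the ideal only by its exponent at \<open>i\<close> dropping from
  \<open>D i\<close> to \<open>D i - 1\<close>, and exactly there the coefficient vanishes.\<close>

lemma lower_mon_ideal:
  fixes p :: "'a::comm_ring_1 mpoly"
  assumes "p \<in> mon_ideal n n D"
  shows "lower n D p \<in> mon_ideal n n D"
proof -
  have "keys (lower n D p) \<subseteq> nonreduced n n D"
    unfolding lower_def
  proof (intro keys_lin keys_sum_subset)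
    fix b i assume b: "b \<in> keys p" and i: "i \<in> {..<n}"
    obtain j where j: "j < n" "D j \<le> lookup b j"
      using assms b by (auto simp: mon_ideal_def nonreduced_def)
    show "keys (Poly_Mapping.single (lower_monom n i b) (lower_coeff D i b :: 'a)) \<subseteq> nonreduced n n D"
    proof (cases "lower_coeff D i b = (0 :: 'a)")
      case False
      then have "D i \<noteq> lookup b i" by (auto simp: lower_coeff_def)
      then have "D j \<le> lookup (lower_monom n i b) j"
        using j by (auto simp: lookup_lower_monom)
      then have "lower_monom n i b \<in> nonreduced n n D"
        unfolding nonreduced_def using j(1) by (auto simp: lower_monom_def simp del: lookup_exps)
      then show ?thesis by simp
    qed simp
  qed
  then show ?thesis by (simp add: mon_ideal_def)
qed

lemma lin_add_fun: "lin (\<lambda>b. B b + C b) p = lin B p + lin C p"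
  by (simp add: lin_def distrib_left sum.distrib)

lemma varsum_mult_single:
  "varsum n * Poly_Mapping.single b 1 = (\<Sum>k<n. Poly_Mapping.single (Poly_Mapping.single k 1 + b) 1)"
  by (simp add: lin_form_eq sum_distrib_right mult_single)

text \<open>The commutator of lowering and raising acts on a monomial by its weight. Raising at
  \<open>k\<close> commutes with lowering at \<open>i\<close> for distinct indices; for k = i, with
  exponent t, the difference is (t + 1)(D - t - 1) - t(D - t) = D - 1 - 2t.\<close>

lemma lower_varsum_monomial:
  assumes b: "b \<in> monoms n"
  shows "lower n D (varsum n * Poly_Mapping.single b 1) =
    varsum n * lower n D (Poly_Mapping.single b 1)
    + Poly_Mapping.single b ((\<Sum>i<n. of_nat (D i) - 1) - 2 * of_nat (mdeg b) :: 'a::comm_ring_1)"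
proof -
  let ?e = "\<lambda>k::nat. Poly_Mapping.single k (1::nat)"
  have kb: "keys b \<subseteq> {..<n}" using b by (simp add: monoms_def)
  have *: "Poly_Mapping.single (lower_monom n i (?e k + b)) (lower_coeff D i (?e k + b))
      = Poly_Mapping.single (?e k + lower_monom n i b) (lower_coeff D i b)
        + (if k = i then Poly_Mapping.single b (of_nat (D k) - 1 - 2 * of_nat (lookup b k) :: 'a) else 0)"
    if ik: "i < n" "k < n" for i k
  proof (cases "k = i")
    case False
    then have "lower_monom n i (?e k + b) = ?e k + lower_monom n i b"
      using ik by (intro poly_mapping_eqI) (auto simp: lookup_lower_monom lookup_add lookup_single)
    moreover have "lower_coeff D i (?e k + b) = (lower_coeff D i b :: 'a)"
      using False by (simp add: lower_coeff_def lookup_add lookup_single)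
    ultimately show ?thesis using False by simp
  next
    case True
    have l: "lower_monom n i (?e k + b) = b"
      using True ik lookup_outside[OF kb]
      by (intro poly_mapping_eqI) (auto simp: lookup_lower_monom lookup_add lookup_single)
    \<comment> \<open>At exponent 0, lowering and then raising does not return to \<open>b\<close>,
      but both sides are zero because the coefficient is.\<close>
    have r: "Poly_Mapping.single (?e k + lower_monom n i b) (lower_coeff D i b) = Poly_Mapping.single b (lower_coeff D i b :: 'a)"
    proof (cases "lookup b i = 0")
      case False
      then have "?e k + lower_monom n i b = b"
        using True ik lookup_outside[OF kb]
        by (intro poly_mapping_eqI) (auto simp: lookup_lower_monom lookup_add lookup_single)
      then show ?thesis by simp
    qed (simp add: lower_coeff_def)
    have "lower_coeff D i (?e k + b) = lower_coeff D i b + (of_nat (D k) - 1 - 2 * of_nat (lookup b k) :: 'a)"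
      using True by (simp add: lower_coeff_def lookup_add algebra_simps)
    then show ?thesis unfolding l r using True by (simp add: single_add)
  qed
  have "lower n D (varsum n * Poly_Mapping.single b 1) =
      (\<Sum>k<n. \<Sum>i<n. Poly_Mapping.single (lower_monom n i (?e k + b)) (lower_coeff D i (?e k + b)))"
    by (simp add: varsum_mult_single lower_def lin_sum)
  also have "\<dots> = (\<Sum>k<n. \<Sum>i<n. Poly_Mapping.single (?e k + lower_monom n i b) (lower_coeff D i b))
      + (\<Sum>k<n. Poly_Mapping.single b (of_nat (D k) - 1 - 2 * of_nat (lookup b k) :: 'a))"
    by (simp add: * sum.distrib del: One_nat_def)
  also have "(\<Sum>k<n. \<Sum>i<n. Poly_Mapping.single (?e k + lower_monom n i b) (lower_coeff D i b))
      = varsum n * lower n D (Poly_Mapping.single b (1 :: 'a))"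
    by (simp add: lower_def lin_form_eq sum_product mult_single)
  also have "(\<Sum>k<n. Poly_Mapping.single b (of_nat (D k) - 1 - 2 * of_nat (lookup b k) :: 'a))
      = Poly_Mapping.single b (\<Sum>k<n. of_nat (D k) - 1 - 2 * of_nat (lookup b k))"
    by (rule poly_mapping_eqI) (simp add: lookup_sum lookup_single when_def)
  also have "(\<Sum>k<n. of_nat (D k) - 1 - 2 * of_nat (lookup b k) :: 'a)
      = (\<Sum>i<n. of_nat (D i) - 1) - 2 * of_nat (mdeg b)"
    by (simp add: mdeg_eq_sum[OF kb] sum_subtractf sum_distrib_left)
  finally show ?thesis .
qed

text \<open>All monomials of a homogeneous polynomial have the same weight, so by linearity the
  commutator acts on it as one scalar.\<close>

lemma lower_varsum:
  fixes p :: "'a::comm_ring_1 mpoly"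
  assumes "p \<in> homog n d"
  shows "lower n D (varsum n * p) =
    varsum n * lower n D p + Const ((\<Sum>i<n. of_nat (D i) - 1) - 2 * of_nat d) * p"
proof -
  let ?s = "\<lambda>b. Poly_Mapping.single b (1 :: 'a)"
  let ?c = "Const ((\<Sum>i<n. of_nat (D i) - 1) - 2 * of_nat d)"
  have p: "p = lin ?s p" by simp
  have "lower n D (varsum n * p) = lin (\<lambda>b. lower n D (varsum n * ?s b)) p"
    by (subst p) (simp add: mult_lin lower_def lin_lin del: lin_monomials)
  also have "\<dots> = lin (\<lambda>b. varsum n * lower n D (?s b) + ?c * ?s b) p"
    using assms
    by (intro lin_cong) (auto simp: lower_varsum_monomial homog_iff Const_mult_single)
  also have "\<dots> = varsum n * lin (\<lambda>b. lower n D (?s b)) p + ?c * lin ?s p"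
    unfolding lin_add_fun by (simp only: mult_lin)
  also have "lin (\<lambda>b. lower n D (?s b)) p = lower n D (lin ?s p)"
    by (simp add: lower_def lin_lin del: lin_monomials)
  finally show ?thesis by simp
qed

text \<open>Moving the lowering operator past one raising factor after another collects the weights
  s - 2d - 2j for j = 0, ..., k, where s is the sum of the \<open>D i - 1\<close>. Their total is (k
  + 1)(s - 2d - k).\<close>

lemma lower_varsum_power:
  fixes p :: "'a::comm_ring_1 mpoly"
  assumes "p \<in> homog n d"
  shows "lower n D (varsum n ^ Suc k * p) = varsum n ^ Suc k * lower n D p
    + Const (of_nat (Suc k) * ((\<Sum>i<n. of_nat (D i) - 1) - 2 * of_nat d - of_nat k)) * (varsum n ^ k * p)"
proof (induction k)
  case 0
  then show ?case using lower_varsum[OF assms] by simp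
next
  case (Suc k)
  let ?s = "\<Sum>i<n. of_nat (D i) - (1 :: 'a)"
  let ?q = "varsum n ^ Suc k * p"
  have "?q \<in> homog n (Suc k * 1 + d)"
    by (intro homog_mult homog_power homog_lin_form assms)
  then have q: "lower n D (varsum n * ?q) =
      varsum n * lower n D ?q + Const (?s - 2 * of_nat (Suc k * 1 + d)) * ?q"
    by (rule lower_varsum)
  have c: "of_nat (Suc (Suc k)) * (?s - 2 * of_nat d - of_nat (Suc k))
      = of_nat (Suc k) * (?s - 2 * of_nat d - of_nat k) + (?s - 2 * of_nat (Suc k * 1 + d))"
    by (simp add: algebra_simps)
  have pow: "varsum n ^ Suc (Suc k) * p = varsum n * ?q"
    by (simp only: power_Suc mult.assoc)
  have "lower n D (varsum n ^ Suc (Suc k) * p) = varsum n * lower n D ?q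
      + Const (?s - 2 * of_nat (Suc k * 1 + d)) * ?q"
    unfolding pow by (rule q)
  also have "varsum n * lower n D ?q = varsum n ^ Suc (Suc k) * lower n D p
      + Const (of_nat (Suc k) * (?s - 2 * of_nat d - of_nat k)) * ?q"
    unfolding Suc.IH by (simp add: algebra_simps)
  finally show ?case unfolding c Const_add by (simp only: distrib_right add.assoc)
qed

lemma varsum_power_polyR: "varsum n ^ k \<in> polyR n"
  by (rule homog_polyR[OF homog_power[OF homog_lin_form]])

lemma mon_ideal_cancel:
  fixes p :: "'a::field mpoly"
  assumes "Const c * p \<in> mon_ideal n k D" "c \<noteq> 0"
  shows "p \<in> mon_ideal n k D"
proof -
  have "Const (inverse c) * (Const c * p) = p"
    using assms(2) by (intro poly_mapping_eqI) simp
  then show ?thesis using mon_ideal_Const_mult[OF assms(1), of "inverse c"] by metis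
qed

text \<open>The argument with lowest weight vectors, carried out modulo the ideal: by induction on
  the degree, lowering sends \<open>p\<close> into the ideal, and then lowering strips the factors
  \<open>varsum n\<close> off the given product one at a time.\<close>

lemma lefschetz_mon_ideal:
  fixes p :: "'a::field_char_0 mpoly"
  assumes D: "\<And>i. i < n \<Longrightarrow> 0 < D i"
    and "2 * d \<le> (\<Sum>i<n. D i - 1)" "p \<in> homog n d"
    and "varsum n ^ ((\<Sum>i<n. D i - 1) - 2 * d) * p \<in> mon_ideal n n D"
  shows "p \<in> mon_ideal n n D"
  using assms(2-)
proof (induction d arbitrary: p rule: less_induct)
  case (less d)
  define w where "w = (\<Sum>i<n. D i - 1) - 2 * d"
  have s: "(\<Sum>i<n. of_nat (D i) - 1) = 2 * of_nat d + (of_nat w :: 'a)"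
  proof -
    \<comment> \<open>Positivity of the \<open>D i\<close> makes truncated subtraction agree with
      subtraction in the field.\<close>
    have "(\<Sum>i<n. of_nat (D i) - 1) = (of_nat (\<Sum>i<n. D i - 1) :: 'a)"
      using D by (simp add: of_nat_diff Suc_leI)
    also have "(\<Sum>i<n. D i - 1) = 2 * d + w" using less.prems(1) by (simp add: w_def)
    finally show ?thesis by simp
  qed
  have w: "varsum n ^ w * p \<in> mon_ideal n n D" using less.prems(3) by (simp add: w_def)
  have mult: "varsum n ^ k * q \<in> mon_ideal n n D" if "q \<in> mon_ideal n n D" for k and q :: "'a mpoly"
    by (rule mon_ideal_mult[OF varsum_power_polyR that])
  have low: "lower n D p \<in> mon_ideal n n D"
  proof (cases d)
    case 0
    then show ?thesis using lower_homog_0[of p n D] less.prems(2) by (simp add: mon_ideal_def)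
  next
    case (Suc d')
    have "varsum n ^ Suc w * p \<in> mon_ideal n n D"
      using mult[OF w, of 1] by (simp add: mult.assoc)
    then have "lower n D (varsum n ^ Suc w * p) \<in> mon_ideal n n D" by (rule lower_mon_ideal)
    \<comment> \<open>At exponent \<open>Suc w\<close> the commutator scalar contains the factor (2d
      + w) - 2d - w = 0, so only this term survives.\<close>
    then have "varsum n ^ Suc w * lower n D p \<in> mon_ideal n n D"
      unfolding lower_varsum_power[OF less.prems(2)] s by simp
    from mult[OF this, of 1] have "varsum n ^ Suc (Suc w) * lower n D p \<in> mon_ideal n n D"
      by (simp add: mult.assoc)
    \<comment> \<open>One more factor reaches precisely the exponent that the induction hypothesis
      wants in degree d - 1.\<close>
    moreover have "Suc (Suc w) = (\<Sum>i<n. D i - 1) - 2 * d'"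
      using less.prems(1) Suc by (simp add: w_def)
    ultimately have low': "varsum n ^ ((\<Sum>i<n. D i - 1) - 2 * d') * lower n D p \<in> mon_ideal n n D"
      by (simp only:)
    have "d' < d" "2 * d' \<le> (\<Sum>i<n. D i - 1)" "lower n D p \<in> homog n d'"
      using less.prems(1,2) Suc lower_homog[of p n d' D] by simp_all
    then show ?thesis using low' by (rule less.IH)
  qed
  \<comment> \<open>Descent on the exponent: as \<open>lower n D p\<close> lies in the ideal,
    lowering the product with exponent k + 1 leaves (k + 1)(w - k) times the product with exponent
    k. For k < w this scalar is nonzero in characteristic 0.\<close>
  have "p \<in> mon_ideal n n D" if "k \<le> w" "varsum n ^ k * p \<in> mon_ideal n n D" for k
    using that
  proof (induction k)
    case (Suc k)
    let ?c = "of_nat (Suc k) * (2 * of_nat d + of_nat w - 2 * of_nat d - of_nat k) :: 'a"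
    have "lower n D (varsum n ^ Suc k * p) \<in> mon_ideal n n D"
      using Suc.prems(2) by (rule lower_mon_ideal)
    from mon_ideal_diff[OF this mult[OF low, of "Suc k"]]
    have "Const ?c * (varsum n ^ k * p) \<in> mon_ideal n n D"
      unfolding lower_varsum_power[OF less.prems(2)] s by simp
    moreover have "?c \<noteq> 0"
      using Suc.prems(1) by (simp del: of_nat_Suc)
    ultimately have "varsum n ^ k * p \<in> mon_ideal n n D" by (rule mon_ideal_cancel)
    then show ?case using Suc by simp
  qed simp
  then show ?case using w by blast
qed

section \<open>Transport from the monomial ideal\<close>

definition reduced :: "nat \<Rightarrow> (nat \<Rightarrow> nat) \<Rightarrow> (nat \<Rightarrow>\<^sub>0 nat) \<Rightarrow> bool" where
  "reduced n D b \<longleftrightarrow> (\<forall>i<n. lookup b i < D i)"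

text \<open>The dual monomial: for reduced \<open>b\<close> the exponents of \<open>b\<close> and
  its complement add up to the socle monomial, the product of the x_i^(D i - 1).\<close>

definition complement :: "nat \<Rightarrow> (nat \<Rightarrow> nat) \<Rightarrow> (nat \<Rightarrow>\<^sub>0 nat) \<Rightarrow> (nat \<Rightarrow>\<^sub>0 nat)" where
  "complement n D b = exps n (\<lambda>i. D i - 1 - lookup b i)"

definition socle_exp :: "nat \<Rightarrow> (nat \<Rightarrow> nat) \<Rightarrow> nat" where
  "socle_exp n D = (\<Sum>i<n. D i - 1)"

text \<open>On the span of the reduced monomials this is the duality between degrees k and c - k,
  where c is \<open>socle_exp n D\<close>. Killing the other monomials makes it vanish on the
  monomial ideal.\<close>

definition reflect :: "nat \<Rightarrow> (nat \<Rightarrow> nat) \<Rightarrow> 'a::comm_ring_1 mpoly \<Rightarrow> 'a mpoly" where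
  "reflect n D = lin (\<lambda>b. if reduced n D b then Poly_Mapping.single (complement n D b) 1 else 0)"

text \<open>The projection onto the monomial ideal along the span of the reduced monomials.\<close>

definition nonreduced_part :: "nat \<Rightarrow> (nat \<Rightarrow> nat) \<Rightarrow> 'a::comm_ring_1 mpoly \<Rightarrow> 'a mpoly" where
  "nonreduced_part n D = lin (\<lambda>b. if reduced n D b then 0 else Poly_Mapping.single b 1)"

lemma nonreduced_iff: "b \<in> nonreduced n n D \<longleftrightarrow> b \<in> monoms n \<and> \<not> reduced n D b"
  by (auto simp: nonreduced_def reduced_def not_less)

lemma mon_ideal_iff:
  "p \<in> mon_ideal n n D \<longleftrightarrow> p \<in> polyR n \<and> (\<forall>b\<in>keys p. \<not> reduced n D b)"
  by (auto simp: mon_ideal_def polyR_iff nonreduced_iff)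

lemma mon_ideal_polyR: "p \<in> mon_ideal n k D \<Longrightarrow> p \<in> polyR n"
  by (auto simp: mon_ideal_def polyR_iff nonreduced_def)

lemma reduced_mdeg:
  assumes "reduced n D b" "b \<in> monoms n"
  shows "mdeg b \<le> socle_exp n D" "mdeg (complement n D b) = socle_exp n D - mdeg b"
proof -
  have *: "lookup b i \<le> D i - 1" if "i < n" for i
    using assms(1) that by (fastforce simp: reduced_def)
  have deg: "mdeg b = (\<Sum>i<n. lookup b i)"
    using assms(2) by (intro mdeg_eq_sum) (simp add: monoms_def)
  show "mdeg b \<le> socle_exp n D"
    unfolding deg socle_exp_def using * by (intro sum_mono) auto
  show "mdeg (complement n D b) = socle_exp n D - mdeg b"
    unfolding deg socle_exp_def complement_def mdeg_exps using * by (intro sum_subtractf_nat) auto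
qed

lemma complement_monoms: "complement n D b \<in> monoms n"
  by (simp add: complement_def)

lemma reduced_complement: "(\<And>i. i < n \<Longrightarrow> 0 < D i) \<Longrightarrow> reduced n D (complement n D b)"
  by (auto simp: reduced_def complement_def less_imp_diff_less)

lemma complement_complement:
  assumes "reduced n D b" "b \<in> monoms n"
  shows "complement n D (complement n D b) = b"
proof (rule poly_mapping_eqI)
  fix i
  show "lookup (complement n D (complement n D b)) i = lookup b i"
    using assms lookup_outside[of b n i] by (cases "i < n") (auto simp: complement_def reduced_def monoms_def)
qed

lemma reflect_homog:
  assumes "p \<in> homog n d"
  shows "reflect n D p \<in> homog n (socle_exp n D - d)"
proof -
  have "keys (reflect n D p) \<subseteq> {m \<in> monoms n. mdeg m = socle_exp n D - d}"
    unfolding reflect_def using assms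
    by (intro keys_lin) (auto simp: homog_iff complement_monoms reduced_mdeg)
  then show ?thesis by (simp add: homog_iff)
qed

lemma reflect_mon_ideal: "p \<in> mon_ideal n n D \<Longrightarrow> reflect n D p = 0"
  by (simp add: reflect_def mon_ideal_iff lin_def)

lemma nonreduced_part_mon_ideal: "p \<in> mon_ideal n n D \<Longrightarrow> nonreduced_part n D p = p"
proof -
  assume "p \<in> mon_ideal n n D"
  then have "nonreduced_part n D p = lin (\<lambda>b. Poly_Mapping.single b 1) p"
    unfolding nonreduced_part_def by (intro lin_cong) (simp add: mon_ideal_iff)
  then show ?thesis by simp
qed

lemma nonreduced_part_in_mon_ideal:
  assumes "p \<in> polyR n"
  shows "nonreduced_part n D p \<in> mon_ideal n n D"
proof -
  have "keys (nonreduced_part n D p) \<subseteq> nonreduced n n D"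
    unfolding nonreduced_part_def using assms
    by (intro keys_lin) (auto simp: polyR_iff nonreduced_iff)
  then show ?thesis by (simp add: mon_ideal_def)
qed

lemma lin_zero_fun: "(\<And>b. b \<in> keys p \<Longrightarrow> B b = 0) \<Longrightarrow> lin B p = 0"
  by (simp add: lin_def)

lemma nonreduced_part_reflect:
  assumes "\<And>i. i < n \<Longrightarrow> 0 < D i"
  shows "nonreduced_part n D (reflect n D p) = 0"
  unfolding nonreduced_part_def reflect_def lin_lin
  by (intro lin_zero_fun) (auto simp: reduced_complement[OF assms] split: if_splits)

lemma lin_diff_fun: "lin (\<lambda>b. B b - C b) p = lin B p - lin C p"
  by (simp add: lin_def right_diff_distrib sum_subtractf)

lemma reflect_reflect:
  assumes D: "\<And>i. i < n \<Longrightarrow> 0 < D i" and p: "p \<in> polyR n"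
  shows "reflect n D (reflect n D p) = p - nonreduced_part n D p"
proof -
  have "reflect n D (reflect n D p) =
      lin (\<lambda>b. Poly_Mapping.single b 1 - (if reduced n D b then 0 else Poly_Mapping.single b 1)) p"
    unfolding reflect_def lin_lin using p
    by (intro lin_cong)
      (auto simp: reduced_complement[OF D] complement_complement polyR_iff)
  then show ?thesis unfolding lin_diff_fun nonreduced_part_def by simp
qed

section \<open>The two families that become bases at the generic point\<close>

definition fbasis :: "nat \<Rightarrow> (nat \<Rightarrow> nat) \<Rightarrow> (nat \<Rightarrow> 'a::comm_ring_1 mpoly) \<Rightarrow> (nat \<Rightarrow>\<^sub>0 nat) \<Rightarrow> 'a mpoly" where
  "fbasis n D F b = Poly_Mapping.single (exps n (\<lambda>i. lookup b i mod D i)) 1 * (\<Prod>i<n. F i ^ (lookup b i div D i))"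

text \<open>In degree c - d the exponent \<open>w\<close> is taken as c - 2d. The complement of a
  reduced \<open>b\<close> then has degree d, so the replacement does not change the degree.\<close>

definition lbasis :: "nat \<Rightarrow> (nat \<Rightarrow> nat) \<Rightarrow> (nat \<Rightarrow> 'a::comm_ring_1 mpoly) \<Rightarrow> nat \<Rightarrow> (nat \<Rightarrow>\<^sub>0 nat) \<Rightarrow> 'a mpoly" where
  "lbasis n D F w b = (if reduced n D b then varsum n ^ w * Poly_Mapping.single (complement n D b) 1 else fbasis n D F b)"

lemma fbasis_homog:
  assumes F: "\<And>i. i < n \<Longrightarrow> F i \<in> homog n (D i)" and b: "b \<in> monoms n"
  shows "fbasis n D F b \<in> homog n (mdeg b)"
proof -
  have "fbasis n D F b \<in> homog n (mdeg (exps n (\<lambda>i. lookup b i mod D i)) + (\<Sum>i<n. lookup b i div D i * D i))"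
    unfolding fbasis_def
  proof (rule homog_mult)
    show "Poly_Mapping.single (exps n (\<lambda>i. lookup b i mod D i)) 1
        \<in> homog n (mdeg (exps n (\<lambda>i. lookup b i mod D i)))"
      by (rule homog_single) simp
    show "(\<Prod>i<n. F i ^ (lookup b i div D i)) \<in> homog n (\<Sum>i<n. lookup b i div D i * D i)"
      using F by (intro homog_prod[where f = "\<lambda>i. F i ^ (lookup b i div D i)"] homog_power) simp
  qed
  also have "mdeg (exps n (\<lambda>i. lookup b i mod D i)) + (\<Sum>i<n. lookup b i div D i * D i) = mdeg b"
    using b mdeg_eq_sum[of b n] by (simp add: monoms_def flip: sum.distrib)
  finally show ?thesis .
qed

lemma fbasis_reduced:
  assumes "reduced n D b" "b \<in> monoms n"
  shows "fbasis n D F b = Poly_Mapping.single b 1"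
proof -
  have "exps n (\<lambda>i. lookup b i mod D i) = b"
    using assms lookup_outside[of b n]
    by (intro poly_mapping_eqI) (simp add: reduced_def monoms_def)
  moreover have "(\<Prod>i<n. F i ^ (lookup b i div D i)) = 1"
    using assms(1) by (intro prod.neutral) (simp add: reduced_def)
  ultimately show ?thesis by (simp add: fbasis_def)
qed

text \<open>Adding \<open>D j\<close> to the exponent at \<open>j\<close> keeps every remainder and
  raises one quotient by one. This is why the transport map turns a power of a variable into a
  generator.\<close>

lemma fbasis_shift:
  assumes j: "j < n" and D: "0 < D j"
  shows "fbasis n D F (Poly_Mapping.single j (D j) + b) = F j * fbasis n D F b"
proof -
  let ?b = "Poly_Mapping.single j (D j) + b"
  have "exps n (\<lambda>i. lookup ?b i mod D i) = exps n (\<lambda>i. lookup b i mod D i)"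
    by (rule poly_mapping_eqI) (simp add: lookup_add lookup_single when_def)
  moreover have "(\<Prod>i<n. F i ^ (lookup ?b i div D i)) = F j * (\<Prod>i<n. F i ^ (lookup b i div D i))"
  proof -
    have "(\<Prod>i<n. F i ^ (lookup ?b i div D i)) = (\<Prod>i<n. (if i = j then F j else 1) * F i ^ (lookup b i div D i))"
      using D by (intro prod.cong) (auto simp: lookup_add lookup_single)
    then show ?thesis using j by (simp add: prod.distrib)
  qed
  ultimately show ?thesis by (simp add: fbasis_def mult_ac)
qed

lemma lbasis_homog:
  assumes F: "\<And>i. i < n \<Longrightarrow> F i \<in> homog n (D i)" and b: "b \<in> monoms n"
    and w: "2 * d \<le> socle_exp n D" "mdeg b = socle_exp n D - d"
  shows "lbasis n D F (socle_exp n D - 2 * d) b \<in> homog n (socle_exp n D - d)"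
proof (cases "reduced n D b")
  case True
  have "varsum n ^ (socle_exp n D - 2 * d) * Poly_Mapping.single (complement n D b) 1
      \<in> homog n ((socle_exp n D - 2 * d) * 1 + mdeg (complement n D b))"
    by (intro homog_mult homog_power homog_lin_form homog_single complement_monoms)
  also have "(socle_exp n D - 2 * d) * 1 + mdeg (complement n D b) = socle_exp n D - d"
    using reduced_mdeg[OF True b] w by simp
  finally show ?thesis using True by (simp add: lbasis_def)
next
  case False
  then show ?thesis using fbasis_homog[OF F b] w by (simp add: lbasis_def)
qed

text \<open>This separates the image of the power of \<open>varsum n\<close> from a part that will
  lie in the ideal; injectivity and surjectivity are both read off this splitting.\<close>

lemma lin_lbasis:
  "lin (lbasis n D F w) p = varsum n ^ w * reflect n D p + lin (fbasis n D F) (nonreduced_part n D p)"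
proof -
  have "lin (lbasis n D F w) p = lin (\<lambda>b.
      varsum n ^ w * (if reduced n D b then Poly_Mapping.single (complement n D b) 1 else 0)
      + lin (fbasis n D F) (if reduced n D b then 0 else Poly_Mapping.single b 1)) p"
    by (intro lin_cong) (simp add: lbasis_def)
  then show ?thesis
    unfolding lin_add_fun by (simp add: nonreduced_part_def reflect_def mult_lin lin_lin)
qed

text \<open>Everything that the generic point has to supply; the rest is algebra over any
  commutative ring. Surjectivity is stated degree by degree so that preimages stay
  homogeneous.\<close>

locale monomial_transport =
  fixes n :: nat and D :: "nat \<Rightarrow> nat" and F :: "nat \<Rightarrow> 'a::comm_ring_1 mpoly"
  assumes D_pos: "\<And>i. i < n \<Longrightarrow> 0 < D i"
    and F_homog: "\<And>i. i < n \<Longrightarrow> F i \<in> homog n (D i)"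
    and inj_fbasis: "\<And>q. q \<in> polyR n \<Longrightarrow> lin (fbasis n D F) q = 0 \<Longrightarrow> q = 0"
    and surj_fbasis: "\<And>p d. p \<in> homog n d \<Longrightarrow> \<exists>q\<in>homog n d. lin (fbasis n D F) q = p"
    and inj_lbasis: "\<And>q d. 2 * d \<le> socle_exp n D \<Longrightarrow> q \<in> homog n (socle_exp n D - d) \<Longrightarrow>
      lin (lbasis n D F (socle_exp n D - 2 * d)) q = 0 \<Longrightarrow> q = 0"
    and surj_lbasis: "\<And>p d. 2 * d \<le> socle_exp n D \<Longrightarrow> p \<in> homog n (socle_exp n D - d) \<Longrightarrow>
      \<exists>q\<in>homog n (socle_exp n D - d). lin (lbasis n D F (socle_exp n D - 2 * d)) q = p"
begin

section \<open>Transport between the monomial ideal and the ideal of the forms\<close>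

abbreviation "\<Phi> \<equiv> lin (fbasis n D F)"

lemma F_polyR: "i < n \<Longrightarrow> F i \<in> polyR n"
  using F_homog homog_polyR by blast

lemma fbasis_polyR: "b \<in> monoms n \<Longrightarrow> fbasis n D F b \<in> polyR n"
  using fbasis_homog[of n F D b] F_homog homog_polyR by blast

lemma surj_polyR:
  assumes "p \<in> polyR n"
  shows "\<exists>q\<in>polyR n. \<Phi> q = p"
proof -
  have "\<exists>q\<in>polyR n. \<Phi> q = Poly_Mapping.single b (lookup p b)" if "b \<in> keys p" for b
    using surj_fbasis[OF homog_single[of b n "lookup p b"]] assms that homog_polyR
    by (fastforce simp: polyR_iff)
  then obtain q where q: "\<And>b. b \<in> keys p \<Longrightarrow> q b \<in> polyR n \<and> \<Phi> (q b) = Poly_Mapping.single b (lookup p b)"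
    by metis
  have "\<Phi> (\<Sum>b\<in>keys p. q b) = (\<Sum>b\<in>keys p. Poly_Mapping.single b (lookup p b))"
    using q by (simp add: lin_sum)
  also have "\<dots> = p" by (rule poly_mapping_sum_single[symmetric]) auto
  finally show ?thesis using q polyR_sum[of "keys p" q n] by blast
qed

lemma inj_polyR: "p \<in> polyR n \<Longrightarrow> q \<in> polyR n \<Longrightarrow> \<Phi> p = \<Phi> q \<Longrightarrow> p = q"
  using inj_fbasis[of "p - q"] by (simp add: polyR_diff lin_diff)

lemma transport_generator:
  assumes "j < n"
  shows "\<Phi> (Poly_Mapping.single (Poly_Mapping.single j (D j)) 1 * q) = F j * \<Phi> q"
  unfolding lin_single_mult mult_lin
  by (intro lin_cong fbasis_shift D_pos assms)

lemma transport_mon_ideal: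
  assumes k: "k \<le> n" and q: "q \<in> mon_ideal n k D"
  shows "\<Phi> q \<in> gen_ideal n k F"
  unfolding lin_def
proof (intro gen_ideal_sum gen_ideal_mult)
  fix b assume "b \<in> keys q"
  then obtain j where j: "j < k" "D j \<le> lookup b j" and b: "b \<in> monoms n"
    using q by (auto simp: mon_ideal_def nonreduced_def)
  \<comment> \<open>The exponent left after one factor x_j^(D j) is split off from
    \<open>b\<close>.\<close>
  define a where "a = exps n ((lookup b)(j := lookup b j - D j))"
  have "b = Poly_Mapping.single j (D j) + a"
    using j k b lookup_outside[of b n]
    by (intro poly_mapping_eqI) (auto simp: a_def lookup_add lookup_single when_def monoms_def)
  then have "fbasis n D F b = F j * fbasis n D F a"
    using fbasis_shift[of j n D F a] j k D_pos by simp
  also have "\<dots> = fbasis n D F a * F j" by (rule mult.commute)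
  also have "\<dots> \<in> gen_ideal n k F"
    using j by (intro gen_ideal_mult gen_ideal_generator fbasis_polyR) (auto simp: a_def)
  finally show "fbasis n D F b \<in> gen_ideal n k F" .
qed auto

text \<open>Although \<Phi> is not multiplicative, each coefficient \<open>g i\<close> has a
  preimage, and multiplying that preimage by x_i^(D i) gives a preimage of
  \<open>g i * F i\<close>.\<close>

lemma gen_ideal_transport:
  assumes k: "k \<le> n" and p: "p \<in> gen_ideal n k F"
  shows "\<exists>q\<in>mon_ideal n k D. \<Phi> q = p"
proof -
  from p obtain g where g: "p = (\<Sum>i<k. g i * F i)" "\<And>i. i < k \<Longrightarrow> g i \<in> polyR n"
    by (auto simp: gen_ideal_def)
  have "\<forall>i\<in>{..<k}. \<exists>q. q \<in> polyR n \<and> \<Phi> q = g i"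
    using surj_polyR g(2) by blast
  from bchoice[OF this] obtain q where q: "\<And>i. i < k \<Longrightarrow> q i \<in> polyR n \<and> \<Phi> (q i) = g i"
    by auto
  let ?x = "\<lambda>i. Poly_Mapping.single (Poly_Mapping.single i (D i)) (1 :: 'a)"
  have "\<Phi> (\<Sum>i<k. ?x i * q i) = p"
    unfolding lin_sum g(1)
    using q k by (intro sum.cong) (simp_all add: transport_generator mult.commute[of "F _"])
  moreover have "(\<Sum>i<k. ?x i * q i) \<in> mon_ideal n k D"
  proof (rule mon_ideal_sum)
    fix i assume i: "i \<in> {..<k}"
    have "Poly_Mapping.single i (D i) \<in> nonreduced n k D"
      unfolding nonreduced_def using i k by (auto intro!: exI[of _ i])
    then have "?x i \<in> mon_ideal n k D"
      by (simp add: mon_ideal_def)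
    then have "q i * ?x i \<in> mon_ideal n k D"
      using i q by (intro mon_ideal_mult) auto
    then show "?x i * q i \<in> mon_ideal n k D" by (simp add: mult.commute)
  qed
  ultimately show ?thesis by blast
qed

text \<open>By injectivity the preimage found in the monomial ideal is \<open>q\<close> itself, so
  membership in the ideal becomes a condition on the support of \<open>q\<close>.\<close>

lemma transport_iff:
  assumes "k \<le> n" "q \<in> polyR n"
  shows "\<Phi> q \<in> gen_ideal n k F \<longleftrightarrow> q \<in> mon_ideal n k D"
  using transport_mon_ideal gen_ideal_transport inj_polyR mon_ideal_polyR assms by metis

lemma transport_reduced_part:
  assumes "q \<in> polyR n"
  shows "\<Phi> (q - nonreduced_part n D q) = q - nonreduced_part n D q"
proof -
  have "q - nonreduced_part n D q =
      lin (\<lambda>b. Poly_Mapping.single b 1 - (if reduced n D b then 0 else Poly_Mapping.single b 1)) q"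
    unfolding lin_diff_fun nonreduced_part_def by simp
  moreover have "\<Phi> \<dots> = \<dots>"
    unfolding lin_lin using assms
    by (intro lin_cong) (auto simp: fbasis_reduced polyR_iff)
  ultimately show ?thesis by simp
qed

text \<open>Multiplication by \<open>F i\<close> pulls back to multiplication by a power of x_i, and
  such a factor does not affect whether a monomial is divisible by x_j^(D j) for some j < i.\<close>

lemma regular_sequence: "regular_sequence n n F"
  unfolding regular_sequence_def
proof (intro conjI allI impI ballI)
  fix i assume "i < n" then show "F i \<in> polyR n" by (rule F_polyR)
next
  have "fbasis n D F 0 = 1"
    using fbasis_reduced[of n D 0 F] D_pos by (simp add: reduced_def)
  then have "\<Phi> 1 = 1" using lin_single[of "fbasis n D F" 0 1] by simp
  moreover have "1 \<notin> mon_ideal n n D"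
    using D_pos by (auto simp: mon_ideal_iff reduced_def)
  ultimately show "1 \<notin> gen_ideal n n F" using transport_iff[of n 1] by simp
next
  fix i g assume i: "i < n" and g: "g \<in> polyR n" "g * F i \<in> gen_ideal n i F"
  let ?e = "Poly_Mapping.single i (D i)"
  let ?x = "Poly_Mapping.single ?e (1 :: 'a)"
  obtain q where q: "q \<in> polyR n" "\<Phi> q = g" using surj_polyR g(1) by blast
  have "\<Phi> (?x * q) = g * F i" unfolding transport_generator[OF i] q(2) by (rule mult.commute)
  moreover have "?x * q \<in> polyR n"
    using i by (intro polyR_mult q(1) homog_polyR[OF homog_single]) simp
  ultimately have xq: "?x * q \<in> mon_ideal n i D" using transport_iff[of i "?x * q"] g(2) i by simp
  have "q \<in> mon_ideal n i D"
    unfolding mon_ideal_def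
  proof (intro CollectI subsetI)
    fix b assume b: "b \<in> keys q"
    then have "?e + b \<in> keys (?x * q)"
      using lookup_single_mult[of ?e 1 q b] by (simp add: in_keys_iff)
    then obtain j where "j < i" "D j \<le> lookup (?e + b) j"
      using xq by (auto simp: mon_ideal_def nonreduced_def)
    then have "j < i" "D j \<le> lookup b j" by (simp_all add: lookup_add lookup_single)
    then show "b \<in> nonreduced n i D"
      using b q(1) by (auto simp: nonreduced_def polyR_iff)
  qed
  then show "g \<in> gen_ideal n i F" using transport_mon_ideal[of i q] i q(2) by simp
qed

lemma homog_subset_gen_ideal:
  assumes "socle_exp n D < d"
  shows "homog n d \<subseteq> gen_ideal n n F"
proof
  fix p :: "'a mpoly" assume "p \<in> homog n d"
  then obtain q where q: "q \<in> homog n d" "\<Phi> q = p" using surj_fbasis by blast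
  then have "q \<in> mon_ideal n n D"
    using reduced_mdeg(1)[of n D] assms
    by (fastforce simp: mon_ideal_iff homog_iff polyR_iff)
  then show "p \<in> gen_ideal n n F" using transport_mon_ideal[of n q] q by simp
qed

lemma socle_degree: "socle_degree n (gen_ideal n n F) (socle_exp n D)"
proof -
  \<comment> \<open>The socle monomial is reduced, hence fixed by the transport and outside the
    ideal.\<close>
  let ?b = "complement n D 0"
  let ?x = "Poly_Mapping.single ?b (1 :: 'a)"
  have r: "reduced n D ?b" by (rule reduced_complement[OF D_pos])
  have r0: "reduced n D 0" using D_pos by (simp add: reduced_def)
  have x: "?x \<in> homog n (socle_exp n D)"
    using homog_single[OF complement_monoms, of n D 0 "1 :: 'a"] reduced_mdeg(2)[OF r0] by simp
  have "\<Phi> ?x = ?x" using fbasis_reduced[OF r complement_monoms, of F] by simp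
  moreover have "?x \<notin> mon_ideal n n D" using r by (simp add: mon_ideal_iff)
  ultimately have "?x \<notin> gen_ideal n n F"
    using transport_iff[of n ?x] homog_polyR[OF x] by simp
  then show ?thesis using x homog_subset_gen_ideal by (auto simp: socle_degree_def)
qed

lemma artinian: "artinian_quotient n (gen_ideal n n F)"
  using homog_subset_gen_ideal unfolding artinian_quotient_def
  by (intro exI[of _ "Suc (socle_exp n D)"]) auto

text \<open>Modulo the ideal, \<open>f\<close> equals its reduced part \<open>r\<close>. The product
  of the power with \<open>r\<close> lies in the ideal and is also \<Phi> of some
  \<open>\<delta>\<close> in the monomial ideal, which is a relation among the members of
  \<open>lbasis\<close>; independence forces \<open>r = 0\<close>.\<close>

lemma varsum_power_injective:
  assumes d: "2 * d \<le> socle_exp n D"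
  shows "mult_injective n (gen_ideal n n F) (varsum n) (socle_exp n D - 2 * d) d"
  unfolding mult_injective_def
proof (intro ballI impI)
  let ?I = "gen_ideal n n F" and ?c = "socle_exp n D"
  let ?z = "varsum n ^ (?c - 2 * d) :: 'a mpoly"
  fix f assume f: "f \<in> homog n d" "?z * f \<in> ?I"
  obtain q where q: "q \<in> homog n d" "\<Phi> q = f" using surj_fbasis f(1) by blast
  note qR = homog_polyR[OF q(1)]
  define r where "r = q - nonreduced_part n D q"
  have r_eq: "r = reflect n D (reflect n D q)"
    unfolding r_def by (rule reflect_reflect[OF D_pos qR, symmetric])
  have non: "\<Phi> (nonreduced_part n D q) \<in> ?I"
    by (intro transport_mon_ideal nonreduced_part_in_mon_ideal qR order_refl)
  have f_eq: "f = r + \<Phi> (nonreduced_part n D q)"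
    using transport_reduced_part[OF qR] q(2) by (simp add: r_def lin_diff algebra_simps)
  have zr_eq: "?z * r = ?z * f - ?z * \<Phi> (nonreduced_part n D q)"
    unfolding f_eq by (simp add: algebra_simps)
  have zr: "?z * r \<in> ?I"
    unfolding zr_eq by (intro gen_ideal_diff gen_ideal_mult f(2) non varsum_power_polyR)
  have refl_q: "reflect n D q \<in> homog n (?c - d)" by (rule reflect_homog[OF q(1)])
  have "r \<in> homog n (?c - (?c - d))" unfolding r_eq by (rule reflect_homog[OF refl_q])
  then have "r \<in> homog n d" using d by simp
  then have "?z * r \<in> homog n ((?c - 2 * d) * 1 + d)"
    by (intro homog_mult homog_power homog_lin_form)
  then have "?z * r \<in> homog n (?c - d)" using d by (simp add: algebra_simps)
  then obtain \<delta> where \<delta>: "\<delta> \<in> homog n (?c - d)" "\<Phi> \<delta> = ?z * r" using surj_fbasis by blast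
  have \<delta>J: "\<delta> \<in> mon_ideal n n D" using transport_iff[of n \<delta>] zr \<delta> homog_polyR[OF \<delta>(1)] by simp
  have "reflect n D q - \<delta> \<in> homog n (?c - d)"
    using refl_q \<delta>(1) by (simp only: homog_iff keys_diff_subset)
  \<comment> \<open>The reduced coordinates of this difference contribute the power times
    \<open>r\<close>, the others contribute the negative of \<Phi> \<open>\<delta>\<close>, and the
    two cancel.\<close>
  moreover have "lin (lbasis n D F (?c - 2 * d)) (reflect n D q - \<delta>) = 0"
  proof -
    have "reflect n D (reflect n D q - \<delta>) = r"
      using reflect_mon_ideal[OF \<delta>J] by (simp add: r_eq) (simp add: reflect_def lin_diff)
    moreover have "nonreduced_part n D (reflect n D q - \<delta>) = - \<delta>"
      using nonreduced_part_reflect[of n D q, OF D_pos] nonreduced_part_mon_ideal[OF \<delta>J]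
      by (simp add: nonreduced_part_def lin_diff)
    moreover have "\<Phi> (- \<delta>) = - \<Phi> \<delta>" using lin_diff[of _ 0 \<delta>] by simp
    ultimately show ?thesis unfolding lin_lbasis \<delta>(2)[symmetric] by (simp add: \<delta>(2))
  qed
  ultimately have "reflect n D q - \<delta> = 0" using inj_lbasis[OF d] by blast
  then have "r = 0" unfolding r_eq using reflect_mon_ideal[OF \<delta>J] by simp
  then show "f \<in> ?I" using f_eq non by simp
qed

text \<open>Expanding \<open>g\<close> in \<open>lbasis\<close>, the reduced coordinates yield a
  multiple of the power of \<open>varsum n\<close> and all others fall into the ideal.\<close>

lemma varsum_power_surjective:
  assumes d: "2 * d \<le> socle_exp n D"
  shows "mult_surjective n (gen_ideal n n F) (varsum n) (socle_exp n D - 2 * d) d"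
  unfolding mult_surjective_def
proof
  let ?I = "gen_ideal n n F" and ?c = "socle_exp n D"
  fix g :: "'a mpoly" assume "g \<in> homog n (d + (?c - 2 * d))"
  then have "g \<in> homog n (?c - d)" using d by (simp add: algebra_simps)
  then obtain q where q: "q \<in> homog n (?c - d)" "lin (lbasis n D F (?c - 2 * d)) q = g"
    using surj_lbasis[OF d] by blast
  have "g - varsum n ^ (?c - 2 * d) * reflect n D q = \<Phi> (nonreduced_part n D q)"
    unfolding q(2)[symmetric] lin_lbasis by simp
  moreover have "\<Phi> (nonreduced_part n D q) \<in> ?I"
    using homog_polyR[OF q(1)] by (intro transport_mon_ideal nonreduced_part_in_mon_ideal) auto
  moreover have "reflect n D q \<in> homog n d"
    using reflect_homog[OF q(1), of D] d by simp
  ultimately show "\<exists>f\<in>homog n d. g - varsum n ^ (?c - 2 * d) * f \<in> ?I"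
    by (intro bexI[of _ "reflect n D q"]) simp_all
qed

text \<open>Every required map is a first or a last factor of one of the bijections from degree d to
  degree c - d: a first factor is injective, a last factor is surjective.\<close>

lemma strong_lefschetz: "strong_lefschetz n (gen_ideal n n F)"
  unfolding strong_lefschetz_def
proof (intro exI conjI bexI allI impI)
  let ?I = "gen_ideal n n F" and ?c = "socle_exp n D"
  show "socle_degree n ?I ?c" by (rule socle_degree)
  show "varsum n \<in> homog n 1" by (rule homog_lin_form)
  fix e i assume "1 \<le> e \<and> e + 1 \<le> ?c \<and> i + e \<le> ?c"
  then have ie: "i + e \<le> ?c" by simp
  show "mult_injective n ?I (varsum n) e i \<or> mult_surjective n ?I (varsum n) e i"
  proof (cases "2 * i + e \<le> ?c")
    case True
    have "mult_injective n ?I (varsum n) e i"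
      unfolding mult_injective_def
    proof (intro ballI impI)
      fix f assume f: "f \<in> homog n i" "varsum n ^ e * f \<in> ?I"
      from gen_ideal_mult[OF f(2) varsum_power_polyR[of n "?c - 2 * i - e"]]
      have "varsum n ^ (?c - 2 * i) * f \<in> ?I"
        using True by (simp add: mult.assoc[symmetric] flip: power_add)
      then show "f \<in> ?I"
        using varsum_power_injective[of i] True f(1) by (simp add: mult_injective_def)
    qed
    then show ?thesis ..
  next
    case False
    \<comment> \<open>The degree dual to i + e; the bijection from degree k onto degree i + e passes
      through degree i because k <= i.\<close>
    define k where "k = ?c - (i + e)"
    have k: "2 * k \<le> ?c" "k + (?c - 2 * k) = i + e" "k \<le> i" "?c - 2 * k = e + (i - k)"
      using False ie by (simp_all add: k_def)
    have "mult_surjective n ?I (varsum n) e i"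
      unfolding mult_surjective_def
    proof
      fix g :: "'a mpoly" assume "g \<in> homog n (i + e)"
      then obtain f where f: "f \<in> homog n k" "g - varsum n ^ (?c - 2 * k) * f \<in> ?I"
        using varsum_power_surjective[OF k(1)] k(2) by (auto simp: mult_surjective_def)
      have "varsum n ^ (i - k) * f \<in> homog n ((i - k) * 1 + k)"
        by (intro homog_mult homog_power homog_lin_form f(1))
      then have "varsum n ^ (i - k) * f \<in> homog n i" using k(3) by simp
      moreover have "g - varsum n ^ e * (varsum n ^ (i - k) * f) \<in> ?I"
        using f(2) unfolding k(4) by (simp add: power_add mult.assoc)
      ultimately show "\<exists>f\<in>homog n i. g - varsum n ^ e * f \<in> ?I" by blast
    qed
    then show ?thesis ..
  qed
qed

end

section \<open>The specialisation to powers of the variables\<close>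

lemma single_power:
  "Poly_Mapping.single (Poly_Mapping.single i e) 1 ^ k
    = (Poly_Mapping.single (Poly_Mapping.single i (k * e)) 1 :: 'a::comm_ring_1 mpoly)"
proof (induction k)
  case (Suc k)
  have "Poly_Mapping.single i e + Poly_Mapping.single i (k * e) = Poly_Mapping.single i (Suc k * e)"
    by (simp only: single_add[symmetric] mult_Suc)
  then show ?case by (simp only: power_Suc Suc.IH mult_single mult_1)
qed simp

lemma prod_single:
  "(\<Prod>i\<in>I. Poly_Mapping.single (a i) (1 :: 'a::comm_ring_1)) = Poly_Mapping.single (\<Sum>i\<in>I. a i :: nat \<Rightarrow>\<^sub>0 nat) 1"
  by (induction I rule: infinite_finite_induct) (simp_all add: mult_single)

lemma fbasis_variables:
  assumes F: "\<And>i. i < n \<Longrightarrow> F i = Poly_Mapping.single (Poly_Mapping.single i (D i)) 1"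
    and b: "b \<in> monoms n"
  shows "fbasis n D F b = Poly_Mapping.single b 1"
proof -
  have "(\<Prod>i<n. F i ^ (lookup b i div D i))
      = Poly_Mapping.single (exps n (\<lambda>i. lookup b i div D i * D i)) 1"
    by (simp add: F single_power prod_single exps_def)
  moreover have "exps n (\<lambda>i. lookup b i mod D i) + exps n (\<lambda>i. lookup b i div D i * D i) = b"
    using b lookup_outside[of b n]
    by (intro poly_mapping_eqI) (simp add: lookup_add monoms_def)
  ultimately show ?thesis by (simp add: fbasis_def mult_single)
qed

section \<open>Generic forms\<close>

lemma rat_multiplier_gen_F: "rat_multiplier (\<lambda>v. gen_F n m d (\<lambda>i j k. v (i, j, k)) i)"
  unfolding gen_F_def
  by (intro rat_multiplier_prod rat_multiplier_power rat_multiplier_lin_form rat_poly_fun_var)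

lemma gen_F_homog: "gen_F n m d \<xi> i \<in> homog n (\<Sum>j<m i. d i j)"
proof -
  have "lin_form n (\<xi> i j) ^ d i j \<in> homog n (d i j)" for j
    using homog_power[OF homog_lin_form, of n "\<xi> i j" "d i j"] by simp
  then show ?thesis unfolding gen_F_def by (intro homog_prod)
qed

lemma rat_multiplier_fbasis:
  assumes "\<And>i. i < n \<Longrightarrow> rat_multiplier (\<lambda>v. F v i)"
  shows "rat_multiplier (\<lambda>v. fbasis n D (F v) b)"
  unfolding fbasis_def using assms
  by (intro rat_multiplier_mult rat_multiplier_prod rat_multiplier_power
      rat_multiplier_single rat_poly_fun_1) simp

lemma rat_multiplier_lbasis:
  assumes "\<And>i. i < n \<Longrightarrow> rat_multiplier (\<lambda>v. F v i)"
  shows "rat_multiplier (\<lambda>v. lbasis n D (F v) w b)"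
proof (cases "reduced n D b")
  case True
  then show ?thesis unfolding lbasis_def
    by (auto intro!: rat_multiplier_mult rat_multiplier_power rat_multiplier_lin_form
        rat_multiplier_single rat_poly_fun_1)
next
  case False
  then show ?thesis using rat_multiplier_fbasis[of n F D b] assms by (simp add: lbasis_def)
qed

text \<open>Here \<open>fbasis\<close> consists of the monomials, so a relation puts the power times
  \<open>reflect n D q\<close> into the monomial ideal. The Lefschetz property there puts
  \<open>reflect n D q\<close> into it too; reflecting again shows that \<open>q\<close> has no
  reduced part, and the relation then reads q = 0.\<close>

lemma lin_lbasis_variables_inj:
  fixes q :: "'a::field_char_0 mpoly"
  assumes D: "\<And>i. i < n \<Longrightarrow> 0 < D i"
    and F: "\<And>i. i < n \<Longrightarrow> F i = Poly_Mapping.single (Poly_Mapping.single i (D i)) 1"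
    and d: "2 * d \<le> socle_exp n D" and q: "q \<in> homog n (socle_exp n D - d)"
    and zero: "lin (lbasis n D F (socle_exp n D - 2 * d)) q = 0"
  shows "q = 0"
proof -
  let ?z = "varsum n ^ (socle_exp n D - 2 * d) :: 'a mpoly"
  note qR = homog_polyR[OF q]
  have non: "nonreduced_part n D q \<in> mon_ideal n n D"
    by (rule nonreduced_part_in_mon_ideal[OF qR])
  have "lin (fbasis n D F) (nonreduced_part n D q) = lin (\<lambda>b. Poly_Mapping.single b 1) (nonreduced_part n D q)"
    using non fbasis_variables[OF F]
    by (intro lin_cong) (auto simp: mon_ideal_def nonreduced_def)
  then have eq: "?z * reflect n D q + nonreduced_part n D q = 0"
    using zero by (simp add: lin_lbasis)
  then have "?z * reflect n D q = 0 - nonreduced_part n D q"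
    by (simp add: eq_neg_iff_add_eq_0)
  also have "\<dots> \<in> mon_ideal n n D"
    by (intro mon_ideal_diff non) (simp add: mon_ideal_def)
  finally have z: "?z * reflect n D q \<in> mon_ideal n n D" .
  have "reflect n D q \<in> homog n d"
    using reflect_homog[OF q, of D] d by simp
  then have "reflect n D q \<in> mon_ideal n n D"
    using lefschetz_mon_ideal[of n D d "reflect n D q"] D d z by (simp add: socle_exp_def)
  then have "reflect n D (reflect n D q) = 0" by (rule reflect_mon_ideal)
  then have q_eq: "q = nonreduced_part n D q" using reflect_reflect[of n D q] D qR by simp
  then have "reflect n D q = 0" using non reflect_mon_ideal by metis
  then show ?thesis using eq q_eq by simp
qed

text \<open>Determinants need finite sets of exponents: a degree bound serves injectivity on
  inhomogeneous polynomials, and a single degree serves the remaining claims and keeps preimages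
  homogeneous.\<close>

lemma monomial_transport_generic:
  fixes F :: "('i \<Rightarrow> 'a::field_char_0) \<Rightarrow> nat \<Rightarrow> 'a mpoly"
  assumes D: "\<And>i. i < n \<Longrightarrow> 0 < D i"
    and F: "\<And>v i. i < n \<Longrightarrow> F v i \<in> homog n (D i)"
    and rat: "\<And>i. i < n \<Longrightarrow> rat_multiplier (\<lambda>v. F v i)"
    and w: "\<And>i. i < n \<Longrightarrow> F w i = Poly_Mapping.single (Poly_Mapping.single i (D i)) 1"
    and vw: "\<And>f. rat_poly_fun f \<Longrightarrow> f w \<noteq> 0 \<Longrightarrow> f v \<noteq> 0"
  shows "monomial_transport n D (F v)"
proof
  fix i assume "i < n"
  then show "0 < D i" "F v i \<in> homog n (D i)" by (rule D, rule F)
next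
  have w_id: "lin (fbasis n D (F w)) q = q" if "keys q \<subseteq> monoms n" for q
  proof -
    have "lin (fbasis n D (F w)) q = lin (\<lambda>b. Poly_Mapping.single b 1) q"
      using that fbasis_variables[OF w] by (intro lin_cong) auto
    then show ?thesis by simp
  qed
  have rf: "rat_coeffs (\<lambda>v. fbasis n D (F v) b)" for b
    by (intro rat_multiplier_coeffs rat_multiplier_fbasis rat)
  have hf: "fbasis n D (F u) b \<in> homog n (mdeg b)" if "b \<in> monoms n" for u b
    using fbasis_homog[of n "F u" D b] F that by blast
  show "q = 0" if q: "q \<in> polyR n" "lin (fbasis n D (F v)) q = 0" for q
  proof -
    \<comment> \<open>For q = 0 the value of \<open>Max\<close> is arbitrary, but then the support
      of \<open>q\<close> is empty and contained in any \<open>T\<close>.\<close>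
    define T where "T = {b \<in> monoms n. mdeg b \<le> Max (mdeg ` keys q)}"
    have T: "finite T" unfolding T_def by (rule finite_monoms)
    have kT: "keys (fbasis n D (F u) b) \<subseteq> T" if "b \<in> T" for u b
      using hf[of b u] that by (auto simp: T_def homog_iff)
    have wT: "p = 0" if "keys p \<subseteq> T" "lin (fbasis n D (F w)) p = 0" for p
      using w_id[of p] that by (auto simp: T_def)
    have "keys q \<subseteq> T" using q(1) by (auto simp: T_def polyR_iff)
    then show ?thesis
      using generic_lin_bijective(1)[where B = "\<lambda>v. fbasis n D (F v)" and T = T and v = v and w = w and q = q]
        T rf kT vw wT q(2) by blast
  qed
  show "\<exists>q\<in>homog n d. lin (fbasis n D (F v)) q = p" if p: "p \<in> homog n d" for p d
  proof -
    define T where "T = {b \<in> monoms n. mdeg b = d}"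
    have T: "finite T"
      unfolding T_def by (rule finite_subset[OF _ finite_monoms[of n d]]) auto
    have kT: "keys (fbasis n D (F u) b) \<subseteq> T" if "b \<in> T" for u b
      using hf[of b u] that by (auto simp: T_def homog_iff)
    have wT: "p = 0" if "keys p \<subseteq> T" "lin (fbasis n D (F w)) p = 0" for p
      using w_id[of p] that by (auto simp: T_def)
    have "keys p \<subseteq> T" using p by (simp add: T_def homog_iff)
    then have "\<exists>q. keys q \<subseteq> T \<and> lin (fbasis n D (F v)) q = p"
      using generic_lin_bijective(2)[where B = "\<lambda>v. fbasis n D (F v)" and T = T and v = v and w = w and p = p]
        T rf kT vw wT by blast
    then show ?thesis by (auto simp: homog_iff T_def)
  qed
  fix d assume d: "2 * d \<le> socle_exp n D"
  let ?e = "socle_exp n D - 2 * d"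
  define T where "T = {b \<in> monoms n. mdeg b = socle_exp n D - d}"
  have T: "finite T"
    unfolding T_def by (rule finite_subset[OF _ finite_monoms[of n "socle_exp n D - d"]]) auto
  have rl: "rat_coeffs (\<lambda>v. lbasis n D (F v) ?e b)" for b
    by (intro rat_multiplier_coeffs rat_multiplier_lbasis rat)
  have kT: "keys (lbasis n D (F u) ?e b) \<subseteq> T" if "b \<in> T" for u b
    using lbasis_homog[of n "F u" D b d] F d that by (simp add: T_def homog_iff)
  have homog_T: "p \<in> homog n (socle_exp n D - d) \<longleftrightarrow> keys p \<subseteq> T" for p :: "'a mpoly"
    by (simp add: homog_iff T_def)
  have wT: "p = 0" if "keys p \<subseteq> T" "lin (lbasis n D (F w) ?e) p = 0" for p
    using lin_lbasis_variables_inj[of n D "F w" d p] D w d that by (simp add: homog_T)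
  show "q = 0" if "q \<in> homog n (socle_exp n D - d)" "lin (lbasis n D (F v) ?e) q = 0" for q
    using generic_lin_bijective(1)[where B = "\<lambda>v. lbasis n D (F v) ?e" and T = T and v = v and w = w and q = q]
      T rl kT vw wT that unfolding homog_T by blast
  show "\<exists>q\<in>homog n (socle_exp n D - d). lin (lbasis n D (F v) ?e) q = p"
    if "p \<in> homog n (socle_exp n D - d)" for p
    using generic_lin_bijective(2)[where B = "\<lambda>v. lbasis n D (F v) ?e" and T = T and v = v and w = w and p = p]
      T rl kT vw wT that unfolding homog_T Bex_def by blast
qed

theorem theorem4p1:
  fixes n :: nat and m :: "nat \<Rightarrow> nat" and d :: "nat \<Rightarrow> nat \<Rightarrow> nat"
    and \<xi> :: "nat \<Rightarrow> nat \<Rightarrow> nat \<Rightarrow> 'a::field_char_0"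
  assumes m_pos: "\<forall>i<n. 0 < m i"
    and d_pos: "\<forall>i<n. \<forall>j<m i. 0 < d i j"
    and indep: "alg_indep_over_Q {(i, j, k). i < n \<and> j < m i \<and> k < n} (\<lambda>(i, j, k). \<xi> i j k)"
  shows "artinian_quotient n (gen_ideal n n (gen_F n m d \<xi>))
         \<and> complete_intersection n (gen_ideal n n (gen_F n m d \<xi>))
         \<and> strong_lefschetz n (gen_ideal n n (gen_F n m d \<xi>))"
proof -
  define S where "S = {(i, j, k). i < n \<and> j < m i \<and> k < n}"
  define D where "D i = (\<Sum>j<m i. d i j)" for i
  define F where "F v = gen_F n m d (\<lambda>i j k. v (i, j, k))" for v :: "nat \<times> nat \<times> nat \<Rightarrow> 'a"
  \<comment> \<open>Algebraic independence controls only the coefficients indexed by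
    \<open>S\<close>, so all others are set to 0.\<close>
  define v where "v s = (if s \<in> S then (\<lambda>(i, j, k). \<xi> i j k) s else 0)" for s
  \<comment> \<open>The specialisation sending each linear form of the i-th generator to x_i. It
    vanishes outside \<open>S\<close>, as the transfer of nonvanishing to \<open>v\<close>
    requires.\<close>
  define w :: "nat \<times> nat \<times> nat \<Rightarrow> 'a"
    where "w s = (if s \<in> S \<and> snd (snd s) = fst s then 1 else 0)" for s
  have "monomial_transport n D (F v)"
  proof (rule monomial_transport_generic[where F = F and v = v and w = w])
    fix i assume i: "i < n"
    have "0 < d i 0" "0 < m i" using i m_pos d_pos by auto
    then show "0 < D i" unfolding D_def by (intro sum_pos2[of _ 0]) auto
    show "rat_multiplier (\<lambda>v. F v i)" unfolding F_def by (rule rat_multiplier_gen_F)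
    show "F u i \<in> homog n (D i)" for u unfolding F_def D_def by (rule gen_F_homog)
    have "lin_form n (\<lambda>k. w (i, j, k)) = Poly_Mapping.single (Poly_Mapping.single i 1) 1" if j: "j < m i" for j
    proof -
      have "lin_form n (\<lambda>k. w (i, j, k))
          = (\<Sum>k<n. if k = i then Poly_Mapping.single (Poly_Mapping.single i 1) 1 else 0)"
        unfolding lin_form_eq using i j by (intro sum.cong) (auto simp: w_def S_def)
      then show ?thesis using i by simp
    qed
    then have "F w i = (\<Prod>j<m i. Poly_Mapping.single (Poly_Mapping.single i (d i j)) 1)"
      unfolding F_def gen_F_def by (intro prod.cong) (simp_all add: single_power)
    also have "\<dots> = Poly_Mapping.single (Poly_Mapping.single i (D i)) 1"
      unfolding prod_single D_def
      by (rule arg_cong[where f = "\<lambda>a. Poly_Mapping.single a 1"], rule poly_mapping_eqI)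
        (simp add: lookup_sum lookup_single when_def)
    finally show "F w i = Poly_Mapping.single (Poly_Mapping.single i (D i)) 1" .
  next
    fix f :: "(nat \<times> nat \<times> nat \<Rightarrow> 'a) \<Rightarrow> 'a"
    assume f: "rat_poly_fun f" "f w \<noteq> 0"
    have "f (\<lambda>s. if s \<in> S then (\<lambda>(i, j, k). \<xi> i j k) s else 0) \<noteq> 0"
      using f(2)
      by (intro alg_indep_nonzero[where f = f and w = w, OF indep[folded S_def] f(1)]) (simp_all add: w_def)
    then show "f v \<noteq> 0" unfolding v_def .
  qed
  then interpret monomial_transport n D "F v" .
  \<comment> \<open>The generators with i < n involve only coefficients indexed by \<open>S\<close>,
    so the extension by zero does not change them.\<close>
  have "gen_F n m d \<xi> i = F v i" if "i < n" for i
    unfolding F_def gen_F_def lin_form_def using that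
    by (intro prod.cong arg_cong2[where f = power] sum.cong refl) (auto simp: v_def S_def)
  then have "gen_ideal n n (gen_F n m d \<xi>) = gen_ideal n n (F v)"
    by (simp add: gen_ideal_def)
  then show ?thesis
    using artinian regular_sequence strong_lefschetz unfolding complete_intersection_def by auto
qed

end
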